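(* Let $L$ be a non-unary relational language and $\kappa$ an infinite cardinal. Consider the twelve equivalence relations $\sim_0,\dots,\sim_{11}$ on the set $\operatorname{Int}_L(\kappa)$ (equivalently, on the set $\operatorname{Mod}_L(\kappa)$ of all $L$-structures with domain $\kappa$) defined in the context. Then: (1) all fifteen of the following inclusions hold and are proper: $\sim_0\subset\sim_1$; $\sim_1\subset\sim_2$; $\sim_1\subset\sim_3$; $\sim_2\subset\sim_4$; $\sim_2\subset\sim_5$; $\sim_3\subset\sim_5$; $\sim_4\subset\sim_6$; $\sim_5\subset\sim_6$; $\sim_5\subset\sim_7$; $\sim_6\subset\sim_8$; $\sim_7\subset\sim_8$; $\sim_7\subset\sim_9$; $\sim_8\subset\sim_{10}$; $\sim_9\subset\sim_{10}$; $\sim_{10}\subset\sim_{11}$; (2) there are no other inclusions: for $k,l\le 11$ we have $\sim_k\subset\sim_l$ if and only if the pair $(k,l)$ belongs to the reflexive transitive closure of the fifteen pairs listed in (1). Consequently, the same statements (1) and (2) hold for the corresponding twelve equivalence relations on the class of all pairs $\langle \mathbb X,L\rangle$, where $L$ is a relational language and $\mathbb X$ an $L$-structure.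
   Context: A relational language is $L=\langle R_i:i\in I\rangle$, where $R_i$ is a relational symbol of arity $n_i\ge 1$; $L$ is unary iff $n_i=1$ for all $i\in I$, and non-unary otherwise. For a non-empty set $X$, $\operatorname{Int}_L(X)$ is the set of all sequences $\rho=\langle\rho_i:i\in I\rangle$ with $\rho_i\subset X^{n_i}$; the $L$-structures with domain $X$ are $\langle X,\rho\rangle$, $\rho\in \operatorname{Int}_L(X)$. An embedding $f:\langle X,\rho\rangle\hookrightarrow\langle Y,\sigma\rangle$ is an injection $f:X\to Y$ such that $\langle x_1,\dots,x_{n_i}\rangle\in\rho_i\Leftrightarrow\langle f(x_1),\dots,f(x_{n_i})\rangle\in\sigma_i$ for all $i\in I$ and all $x_1,\dots,x_{n_i}\in X$. An isomorphism ($\cong$) is a surjective embedding. Two $L$-structures are equimorphic ($\rightleftarrows$) iff each embeds in the other. For a structure $\mathbb X$ with domain $X$, $\mathbb P(\mathbb X)=\{f[X]: f:\mathbb X\hookrightarrow\mathbb X\}$, regarded as the poset $\langle \mathbb P(\mathbb X),\subset\rangle$ when isomorphism, separative quotient or forcing equivalence is mentioned. Write $\mathbb P(\rho)=\mathbb P(\langle X,\rho\rangle)$, and $\rho\cong\sigma$, $\rho\rightleftarrows\sigma$ for the corresponding relations between $\langle X,\rho\rangle$ and $\langle X,\sigma\rangle$. For a partial order $\langle P,\le\rangle$ let $p\le^* q$ iff $\forall r\le p\,\exists s\le r\; s\le q$, and $p=^*q$ iff $p\le^*q$ and $q\le^*p$. The separative quotient $\operatorname{sq}\mathbb P$ is $P/{=^*}$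 ordered by $[p]\trianglelefteq[q]\Leftrightarrow p\le^*q$. Two pre-orders are forcing equivalent ($\mathbb P\equiv\mathbb Q$) iff $\operatorname{ge}(\mathbb P)=\operatorname{ge}(\mathbb Q)$, where $\operatorname{ge}(\mathbb P)=\{V_{\mathbb P}[G]: G \text{ is a } \mathbb P\text{-generic filter over the ground model } V\}$. The relations on $\operatorname{Int}_L(\kappa)$: $\rho\sim_0\sigma\Leftrightarrow\rho=\sigma$; $\rho\sim_1\sigma\Leftrightarrow\mathbb P(\rho)=\mathbb P(\sigma)\wedge\rho\cong\sigma$; $\rho\sim_2\sigma\Leftrightarrow\mathbb P(\rho)=\mathbb P(\sigma)\wedge\rho\rightleftarrows\sigma$; $\rho\sim_3\sigma\Leftrightarrow\rho\cong\sigma$; $\rho\sim_4\sigma\Leftrightarrow\mathbb P(\rho)=\mathbb P(\sigma)$; $\rho\sim_5\sigma\Leftrightarrow\mathbb P(\rho)\cong\mathbb P(\sigma)\wedge\rho\rightleftarrows\sigma$; $\rho\sim_6\sigma\Leftrightarrow\mathbb P(\rho)\cong\mathbb P(\sigma)$; $\rho\sim_7\sigma\Leftrightarrow\operatorname{sq}\mathbb P(\rho)\cong\operatorname{sq}\mathbb P(\sigma)\wedge\rho\rightleftarrows\sigma$; $\rho\sim_8\sigma\Leftrightarrow\operatorname{sq}\mathbb P(\rho)\cong\operatorname{sq}\mathbb P(\sigma)$; $\rho\sim_9\sigma\Leftrightarrow\rho\rightleftarrows\sigma$; $\rho\sim_{10}\sigma\Leftrightarrow\mathbb P(\rho)\equiv\mathbb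 P(\sigma)$; $\rho\sim_{11}\sigma$ always (the full relation). The corresponding relations on the class of pairs $\langle\mathbb X,L_1\rangle,\langle\mathbb Y,L_2\rangle$ are defined by the same conditions with $\mathbb X,\mathbb Y$ in place of $\rho,\sigma$, where $\sim_0$ means $\mathbb X=\mathbb Y$ and $L_1=L_2$, and where $\mathbb X\cong\mathbb Y$ and $\mathbb X\rightleftarrows\mathbb Y$ are understood to include $L_1=L_2$. *)

theory Defs
  imports "HOL-Library.FuncSet"
begin

section \<open>Relational languages and structures\<close>

text \<open>
  A language is a partial map: its domain is the index set, its values are the arities.
  Interpretations are extensional functions (undefined outside the index set) and tuples are lists,
  so that HOL equality of languages and of interpretations is equality of the sequences they stand
  for.
\<close>

type_synonym 'i lang = "'i \<rightharpoonup> nat"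
type_synonym ('i, 'a) struct = "'a set \<times> ('i \<Rightarrow> 'a list set)"

definition language :: "'i lang \<Rightarrow> bool" where
  "language L \<longleftrightarrow> (\<forall>n\<in>ran L. n \<ge> 1)"

definition unary :: "'i lang \<Rightarrow> bool" where
  "unary L \<longleftrightarrow> (\<forall>n\<in>ran L. n = 1)"

definition tuples :: "'a set \<Rightarrow> nat \<Rightarrow> 'a list set" where
  "tuples X n = {xs. length xs = n \<and> set xs \<subseteq> X}"

definition Interp :: "'i lang \<Rightarrow> 'a set \<Rightarrow> ('i \<Rightarrow> 'a list set) set" where
  "Interp L X = (\<Pi>\<^sub>E i\<in>dom L. Pow (tuples X (the (L i))))"

definition Mod :: "'i lang \<Rightarrow> 'a set \<Rightarrow> ('i, 'a) struct set" where
  "Mod L X = {X} \<times> Interp L X"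

definition all_pairs :: "(('i, 'a) struct \<times> 'i lang) set" where
  "all_pairs = {(S, L). language L \<and> (\<exists>X. X \<noteq> {} \<and> S \<in> Mod L X)}"

definition embedding :: "'i lang \<Rightarrow> ('i, 'a) struct \<Rightarrow> ('i, 'a) struct \<Rightarrow> ('a \<Rightarrow> 'a) \<Rightarrow> bool" where
  "embedding L S T f \<longleftrightarrow>
     inj_on f (fst S) \<and> f ` fst S \<subseteq> fst T \<and>
     (\<forall>i\<in>dom L. \<forall>xs\<in>tuples (fst S) (the (L i)). xs \<in> snd S i \<longleftrightarrow> map f xs \<in> snd T i)"

definition isomorphic :: "'i lang \<Rightarrow> ('i, 'a) struct \<Rightarrow> ('i, 'a) struct \<Rightarrow> bool" where
  "isomorphic L S T \<longleftrightarrow> (\<exists>f. embedding L S T f \<and> f ` fst S = fst T)"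

definition equimorphic :: "'i lang \<Rightarrow> ('i, 'a) struct \<Rightarrow> ('i, 'a) struct \<Rightarrow> bool" where
  "equimorphic L S T \<longleftrightarrow> (\<exists>f. embedding L S T f) \<and> (\<exists>g. embedding L T S g)"

definition copies :: "'i lang \<Rightarrow> ('i, 'a) struct \<Rightarrow> 'a set set" where
  "copies L S = {f ` fst S | f. embedding L S S f}"


section \<open>Pre-orders\<close>

text \<open>
  A pre-order is a relation \<open>r\<close>, reflexive on its carrier \<open>Field r\<close>; \<open>(p, q) \<in> r\<close> reads
  \<open>p \<le> q\<close>, that is, \<open>p\<close> is the stronger condition.
\<close>

definition copies_order :: "'i lang \<Rightarrow> ('i, 'a) struct \<Rightarrow> 'a set rel" where
  "copies_order L S = relation_of (\<subseteq>) (copies L S)"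

definition order_isomorphic :: "'p rel \<Rightarrow> 'q rel \<Rightarrow> bool" where
  "order_isomorphic r s \<longleftrightarrow>
     (\<exists>f. bij_betw f (Field r) (Field s) \<and>
          (\<forall>p\<in>Field r. \<forall>q\<in>Field r. (p, q) \<in> r \<longleftrightarrow> (f p, f q) \<in> s))"

definition le_star :: "'p rel \<Rightarrow> 'p rel" where
  "le_star r = {(p, q). p \<in> Field r \<and> q \<in> Field r \<and>
                  (\<forall>t. (t, p) \<in> r \<longrightarrow> (\<exists>s. (s, t) \<in> r \<and> (s, q) \<in> r))}"

definition eq_star :: "'p rel \<Rightarrow> 'p rel" where
  "eq_star r = {(p, q). (p, q) \<in> le_star r \<and> (q, p) \<in> le_star r}"

definition sq :: "'p rel \<Rightarrow> 'p set rel" where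
  "sq r = {(eq_star r `` {p}, eq_star r `` {q}) | p q. (p, q) \<in> le_star r}"


section \<open>Forcing equivalence\<close>

text \<open>
  The ground model \<open>V\<close> is the ambient universe, so generic filters and generic extensions exist only
  in the sense of the forcing relation, which is given here by its usual recursive clauses. A
  sentence of the forcing language of \<open>r\<close> is represented by the predicate ``\<open>p\<close> forces it'' on the
  conditions \<open>p \<in> Field r\<close>. Negation, conjunction and universal quantification have their standard
  clauses; the other connectives are their classical abbreviations. The quantifiers range over
  ground model objects, and also over the names (which are themselves ground model objects).
\<close>

type_synonym 'p sentence = "'p \<Rightarrow> bool"

definition f_not :: "'p rel \<Rightarrow> 'p sentence \<Rightarrow> 'p sentence" where
  "f_not r \<phi> = (\<lambda>p. \<forall>q. (q, p) \<in> r \<longrightarrow> \<not> \<phi> q)"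

definition f_and :: "'p sentence \<Rightarrow> 'p sentence \<Rightarrow> 'p sentence" where
  "f_and \<phi> \<psi> = (\<lambda>p. \<phi> p \<and> \<psi> p)"

definition f_all :: "'x set \<Rightarrow> ('x \<Rightarrow> 'p sentence) \<Rightarrow> 'p sentence" where
  "f_all A \<Phi> = (\<lambda>p. \<forall>x\<in>A. \<Phi> x p)"

definition f_imp :: "'p rel \<Rightarrow> 'p sentence \<Rightarrow> 'p sentence \<Rightarrow> 'p sentence" where
  "f_imp r \<phi> \<psi> = f_not r (f_and \<phi> (f_not r \<psi>))"

definition f_iff :: "'p rel \<Rightarrow> 'p sentence \<Rightarrow> 'p sentence \<Rightarrow> 'p sentence" where
  "f_iff r \<phi> \<psi> = f_and (f_imp r \<phi> \<psi>) (f_imp r \<psi> \<phi>)"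

definition f_ex :: "'p rel \<Rightarrow> 'x set \<Rightarrow> ('x \<Rightarrow> 'p sentence) \<Rightarrow> 'p sentence" where
  "f_ex r A \<Phi> = f_not r (f_all A (\<lambda>x. f_not r (\<Phi> x)))"

text \<open>
  \<open>generic r p\<close> is the sentence \<open>p \<in> G\<close>, for \<open>G\<close> the canonical name of the \<open>r\<close>-generic filter: a
  condition \<open>q\<close> forces it iff the conditions below \<open>p\<close> are dense below \<open>q\<close>.
\<close>

definition generic :: "'p rel \<Rightarrow> 'p \<Rightarrow> 'p sentence" where
  "generic r p = (\<lambda>q. (q, p) \<in> le_star r)"

text \<open>
  Let \<open>K\<close> be (a name for) a subset of \<open>A\<close>, given by the sentences \<open>p \<in> K\<close> for \<open>p \<in> A\<close>. A relation
  \<open>\<tau> \<subseteq> A \<times> B\<close> in the ground model acts as a name for a subset of \<open>B\<close>, with evaluation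
  \<open>\<tau>[K] = {b. \<exists>p\<in>K. (p, b) \<in> \<tau>}\<close>. If \<open>K\<close> is a \<open>V\<close>-generic filter on a pre-order with carrier \<open>A\<close>,
  then the sets \<open>\<tau>[K]\<close> are exactly the subsets of \<open>B\<close> that belong to \<open>V[K]\<close>.
\<close>

definition eval_name :: "'p rel \<Rightarrow> ('x \<Rightarrow> 'p sentence) \<Rightarrow> ('x \<times> 'b) set \<Rightarrow> 'b \<Rightarrow> 'p sentence" where
  "eval_name r K \<tau> b = f_ex r {x. (x, b) \<in> \<tau>} K"

definition dense_in :: "'q rel \<Rightarrow> 'q set \<Rightarrow> bool" where
  "dense_in s D \<longleftrightarrow> D \<subseteq> Field s \<and> (\<forall>q\<in>Field s. \<exists>d\<in>D. (d, q) \<in> s)"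

text \<open>The sentence ``\<open>H\<close> is a \<open>V\<close>-generic filter on \<open>s\<close>'', for a name \<open>H\<close> of a subset of \<open>Field s\<close>.\<close>

definition f_generic_filter :: "'p rel \<Rightarrow> 'q rel \<Rightarrow> ('q \<Rightarrow> 'p sentence) \<Rightarrow> 'p sentence" where
  "f_generic_filter r s H =
     f_and (f_all s (\<lambda>(q, q'). f_imp r (H q) (H q')))
    (f_and (f_all (Field s) (\<lambda>q. f_all (Field s) (\<lambda>q'.
              f_imp r (f_and (H q) (H q')) (f_ex r {t. (t, q) \<in> s \<and> (t, q') \<in> s} H))))
           (f_all {D. dense_in s D} (\<lambda>D. f_ex r D H)))"

text \<open>
  \<open>ge(r) \<subseteq> ge(s)\<close>: for each \<open>r\<close>-generic \<open>G\<close> there is an \<open>s\<close>-generic \<open>H\<close> with \<open>V[H] = V[G]\<close>. Such an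
  \<open>H\<close> belongs to \<open>V[G]\<close>, hence is \<open>\<tau>[G]\<close> for some \<open>\<tau> \<in> V\<close>; then \<open>V[H] \<subseteq> V[G]\<close>, and equality holds
  iff \<open>G \<in> V[H]\<close>, that is, iff \<open>G = \<pi>[H]\<close> for some \<open>\<pi> \<in> V\<close>. By the forcing theorem the whole
  statement is true for all \<open>G\<close> iff it is forced by all conditions.
\<close>

definition ge_subset :: "'p rel \<Rightarrow> 'q rel \<Rightarrow> bool" where
  "ge_subset r s \<longleftrightarrow>
     (\<forall>p\<in>Field r.
        f_ex r (Pow (Field r \<times> Field s)) (\<lambda>\<tau>.
          let H = eval_name r (generic r) \<tau> in
          f_and (f_generic_filter r s H)
            (f_ex r (Pow (Field s \<times> Field r)) (\<lambda>\<pi>.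
               f_all (Field r) (\<lambda>x. f_iff r (generic r x) (eval_name r H \<pi> x))))) p)"

definition forcing_equivalent :: "'p rel \<Rightarrow> 'q rel \<Rightarrow> bool" where
  "forcing_equivalent r s \<longleftrightarrow> ge_subset r s \<and> ge_subset s r"


section \<open>The twelve relations\<close>

definition sim :: "nat \<Rightarrow> ('i, 'a) struct \<times> 'i lang \<Rightarrow> ('i, 'a) struct \<times> 'i lang \<Rightarrow> bool" where
  "sim k = (\<lambda>(X, L1) (Y, L2).
     let same_copies = (copies L1 X = copies L2 Y);
         P = copies_order L1 X;
         Q = copies_order L2 Y;
         isom = (L1 = L2 \<and> isomorphic L1 X Y);
         equim = (L1 = L2 \<and> equimorphic L1 X Y)
     in
       [ X = Y \<and> L1 = L2,
         same_copies \<and> isom,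
         same_copies \<and> equim,
         isom,
         same_copies,
         order_isomorphic P Q \<and> equim,
         order_isomorphic P Q,
         order_isomorphic (sq P) (sq Q) \<and> equim,
         order_isomorphic (sq P) (sq Q),
         equim,
         forcing_equivalent P Q,
         True ] ! k)"

definition sim_Interp :: "'i lang \<Rightarrow> 'a set \<Rightarrow> nat \<Rightarrow> ('i \<Rightarrow> 'a list set) rel" where
  "sim_Interp L X k = {(\<rho>, \<sigma>) \<in> Interp L X \<times> Interp L X. sim k ((X, \<rho>), L) ((X, \<sigma>), L)}"

definition sim_Mod :: "'i lang \<Rightarrow> 'a set \<Rightarrow> nat \<Rightarrow> ('i, 'a) struct rel" where
  "sim_Mod L X k = {(S, T) \<in> Mod L X \<times> Mod L X. sim k (S, L) (T, L)}"

definition sim_all :: "nat \<Rightarrow> (('i, 'a) struct \<times> 'i lang) rel" where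
  "sim_all k = {(A, B) \<in> all_pairs \<times> all_pairs. sim k A B}"

definition basic_pairs :: "(nat \<times> nat) set" where
  "basic_pairs = {(0, 1), (1, 2), (1, 3), (2, 4), (2, 5), (3, 5), (4, 6), (5, 6), (5, 7),
                  (6, 8), (7, 8), (7, 9), (8, 10), (9, 10), (10, 11)}"

definition hierarchy :: "(nat \<Rightarrow> 'x rel) \<Rightarrow> bool" where
  "hierarchy R \<longleftrightarrow>
     (\<forall>(k, l)\<in>basic_pairs. R k \<subset> R l) \<and>
     (\<forall>k\<le>11. \<forall>l\<le>11. R k \<subseteq> R l \<longleftrightarrow> (k, l) \<in> basic_pairs\<^sup>*)"

end

theory Submission
  imports Defs "HOL-Library.Countable"
begin

text \<open>
  The only inclusions with some content are \<open>\<sim>\<^sub>8 \<subseteq> \<sim>\<^sub>1\<^sub>0\<close> and \<open>\<sim>\<^sub>9 \<subseteq> \<sim>\<^sub>1\<^sub>0\<close>. For the latter, an embedding \<open>f\<close> of \<open>X\<close>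
  into an equimorphic \<open>Y\<close> sends a generic filter \<open>G\<close> on the copies of \<open>X\<close> to the filter of all
  copies of \<open>Y\<close> that contain \<open>f[C]\<close> for some \<open>C \<in> G\<close>, and \<open>G\<close> is recovered from this filter.

  Given the inclusions, all negative statements follow from the seven non-inclusions
  \<open>(1,0)\<close>, \<open>(2,3)\<close>, \<open>(3,4)\<close>, \<open>(4,9)\<close>, \<open>(7,6)\<close>, \<open>(9,8)\<close>, \<open>(11,10)\<close>. Each is witnessed by two countable
  digraphs: an arrow and its converse; a zigzag path and its converse; two stars with different
  centres; a star and its converse; a ray with and without an additional isolated vertex; two binary
  trees with an isolated vertex and one binary tree; a binary tree and a ray. The children of a tree
  node are joined by an edge that tells left from right, so the copies of a tree are its cones. Every infinite set carries a
  rigid digraph, and by joining it to a countable digraph one transfers the examples to arbitrary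
  infinite cardinals without changing the poset of copies.
\<close>

section \<open>Forcing equivalence\<close>

text \<open>Forcing equivalence is available only through the forcing relation, so each argument
  about generic filters has to become a density argument on pre-orders. \<open>ge_pair\<close> does
  this once, with two relations between the carriers instead of a map: an embedding need not send a
  copy of X to a copy of Y, and an isomorphism of separative quotients determines a condition only
  up to \<open>eq_star\<close>. Copies are ranges of embeddings, not of automorphisms. The rigid
  part of the coding must therefore admit no self-embedding but the identity, and no embedding may
  mix it with the countable part; this is why all countable digraphs used are asymmetric. The
  invariants behind the last three examples are: for (7,6), whether the copies form a chain, both
  separative quotients being a single point; for (9,8), whether elements of the quotient with a
  common lower bound are comparable; for (11,10), whether below some condition all conditions are
  compatible.\<close>

lemma f_ex_iff:
  "f_ex r A \<Phi> p \<longleftrightarrow> (\<forall>q. (q, p) \<in> r \<longrightarrow> (\<exists>x\<in>A. \<exists>t. (t, q) \<in> r \<and> \<Phi> x t))"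
  unfolding f_ex_def f_not_def f_all_def by blast

lemma f_imp_iff:
  "f_imp r \<phi> \<psi> p \<longleftrightarrow> (\<forall>q. (q, p) \<in> r \<longrightarrow> \<phi> q \<longrightarrow> (\<exists>t. (t, q) \<in> r \<and> \<psi> t))"
  unfolding f_imp_def f_not_def f_and_def by blast

lemma le_starI:
  assumes "p \<in> Field r" "q \<in> Field r" "\<And>t. (t, p) \<in> r \<Longrightarrow> \<exists>s. (s, t) \<in> r \<and> (s, q) \<in> r"
  shows "(p, q) \<in> le_star r"
  using assms unfolding le_star_def by blast

lemma le_starD:
  "(p, q) \<in> le_star r \<Longrightarrow> (t, p) \<in> r \<Longrightarrow> \<exists>s. (s, t) \<in> r \<and> (s, q) \<in> r"
  unfolding le_star_def by blast

lemma le_star_Field: "(p, q) \<in> le_star r \<Longrightarrow> p \<in> Field r \<and> q \<in> Field r"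
  unfolding le_star_def by blast

lemma Field_sq_subset: "Field (sq r) \<subseteq> (\<lambda>p. eq_star r `` {p}) ` Field r"
proof
  fix A assume "A \<in> Field (sq r)"
  then obtain p q where "(p, q) \<in> le_star r" "A = eq_star r `` {p} \<or> A = eq_star r `` {q}"
    unfolding sq_def Field_def by blast
  then show "A \<in> (\<lambda>p. eq_star r `` {p}) ` Field r" using le_star_Field[of p q] by auto
qed

locale preord =
  fixes r :: "'p rel"
  assumes refl: "p \<in> Field r \<Longrightarrow> (p, p) \<in> r"
    and trans: "(p, q) \<in> r \<Longrightarrow> (q, t) \<in> r \<Longrightarrow> (p, t) \<in> r"
begin

lemma le_star: "(p, q) \<in> r \<Longrightarrow> (p, q) \<in> le_star r"
  by (meson FieldI1 FieldI2 le_starI refl trans)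

lemma le_star_refl: "p \<in> Field r \<Longrightarrow> (p, p) \<in> le_star r"
  by (simp add: le_star refl)

lemma le_star_trans:
  assumes "(p, q) \<in> le_star r" "(q, t) \<in> le_star r"
  shows "(p, t) \<in> le_star r"
proof (rule le_starI)
  fix u assume "(u, p) \<in> r"
  then obtain v where v: "(v, u) \<in> r" "(v, q) \<in> r" using assms(1) le_starD by metis
  then obtain w where "(w, v) \<in> r" "(w, t) \<in> r" using assms(2) le_starD by metis
  then show "\<exists>s. (s, u) \<in> r \<and> (s, t) \<in> r" using v trans by blast
qed (use assms le_star_Field in metis)+

lemma eq_star_class_eq_iff:
  assumes "p \<in> Field r"
  shows "eq_star r `` {p} = eq_star r `` {q} \<longleftrightarrow> (p, q) \<in> eq_star r"
proof
  assume "eq_star r `` {p} = eq_star r `` {q}"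
  moreover have "p \<in> eq_star r `` {p}" using assms by (simp add: eq_star_def le_star_refl)
  ultimately show "(p, q) \<in> eq_star r" by (auto simp: eq_star_def)
next
  assume "(p, q) \<in> eq_star r"
  then show "eq_star r `` {p} = eq_star r `` {q}"
    unfolding eq_star_def by (blast intro: le_star_trans)
qed

lemma sq_iff:
  assumes "p \<in> Field r" "q \<in> Field r"
  shows "(eq_star r `` {p}, eq_star r `` {q}) \<in> sq r \<longleftrightarrow> (p, q) \<in> le_star r"
proof
  assume "(eq_star r `` {p}, eq_star r `` {q}) \<in> sq r"
  then obtain p' q' where *: "eq_star r `` {p} = eq_star r `` {p'}"
      "eq_star r `` {q} = eq_star r `` {q'}" "(p', q') \<in> le_star r"
    unfolding sq_def by blast
  then have "(p, p') \<in> eq_star r" "(q, q') \<in> eq_star r"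
    using assms eq_star_class_eq_iff by auto
  then show "(p, q) \<in> le_star r"
    using *(3) unfolding eq_star_def by (blast intro: le_star_trans)
qed (auto simp: sq_def)

lemma Field_sq: "Field (sq r) = (\<lambda>p. eq_star r `` {p}) ` Field r"
proof
  show "Field (sq r) \<subseteq> (\<lambda>p. eq_star r `` {p}) ` Field r" by (rule Field_sq_subset)
  show "(\<lambda>p. eq_star r `` {p}) ` Field r \<subseteq> Field (sq r)"
  proof safe
    fix p assume "p \<in> Field r"
    then show "eq_star r `` {p} \<in> Field (sq r)"
      using FieldI1 sq_iff[of p p] le_star_refl by metis
  qed
qed

end

text \<open>
  Think of \<open>E p q\<close> and \<open>F q p\<close> as \<open>p \<le> q\<close> and \<open>q \<le> p\<close> in an order on the union of both carriers.
  The generic filter \<open>G\<close> is sent to its upward closure \<open>H\<close> along \<open>E\<close>, and \<open>G\<close> is the upward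
  closure of \<open>H\<close> along \<open>F\<close>.
\<close>

locale ge_pair = r: preord r + s: preord s
  for r :: "'p rel" and s :: "'q rel" +
  fixes E :: "('p \<times> 'q) set" and F :: "('q \<times> 'p) set"
  assumes E_Field: "E \<subseteq> Field r \<times> Field s" and F_Field: "F \<subseteq> Field s \<times> Field r"
    and E_mono: "(p', p) \<in> r \<Longrightarrow> (p, q) \<in> E \<Longrightarrow> (q, q') \<in> s \<Longrightarrow> (p', q') \<in> E"
    and F_mono: "(q', q) \<in> s \<Longrightarrow> (q, p) \<in> F \<Longrightarrow> (p, p') \<in> r \<Longrightarrow> (q', p') \<in> F"
    and EF: "(p, q) \<in> E \<Longrightarrow> (q, p') \<in> F \<Longrightarrow> (p, p') \<in> le_star r"
    and FE: "(q, p) \<in> F \<Longrightarrow> (p, q') \<in> E \<Longrightarrow> (q, q') \<in> le_star s"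
    and ex_F: "p \<in> Field r \<Longrightarrow> \<exists>q. (q, p) \<in> F"
    and ex_E: "(q, p) \<in> F \<Longrightarrow> \<exists>p'. (p', q) \<in> E"
begin

lemma F_le: "(q', q) \<in> s \<Longrightarrow> (q, p) \<in> F \<Longrightarrow> (q', p) \<in> F"
  using F_mono[of q' q p p] F_Field r.refl by auto

lemma E_le: "(p', p) \<in> r \<Longrightarrow> (p, q) \<in> E \<Longrightarrow> (p', q) \<in> E"
  using E_mono[of p' p q q] E_Field s.refl by auto

text \<open>By \<open>EF\<close> any \<open>E\<close>-predecessor of \<open>q\<close> is below
  \<open>p\<close> in the sense of \<open>le_star\<close>, so it has a common extension with
  \<open>p\<close>, which is still \<open>E\<close>-below \<open>q\<close>. This is how a condition
  of \<open>s\<close> is brought back to \<open>r\<close>.\<close>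

lemma ex_E_below:
  assumes "(q, p) \<in> F"
  shows "\<exists>p'. (p', p) \<in> r \<and> (p', q) \<in> E"
proof -
  obtain p0 where p0: "(p0, q) \<in> E" using ex_E[OF assms] ..
  then have "(p0, p0) \<in> r" using E_Field r.refl by blast
  then obtain p' where "(p', p0) \<in> r" "(p', p) \<in> r"
    using EF[OF p0 assms] le_starD by metis
  then show ?thesis using E_le p0 by blast
qed

abbreviation H :: "'q \<Rightarrow> 'p sentence" where
  "H \<equiv> eval_name r (generic r) E"

text \<open>Forcing \<open>generic r x\<close> only means \<open>le_star\<close>; passing to a
  common extension with \<open>x\<close> gives a genuine pair of \<open>E\<close>, since
  \<open>E\<close> is closed downwards in its first component.\<close>

lemma H_iff:
  assumes "p \<in> Field r"
  shows "H q p \<longleftrightarrow> (\<forall>p1. (p1, p) \<in> r \<longrightarrow> (\<exists>t. (t, p1) \<in> r \<and> (t, q) \<in> E))"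
proof (intro iffI allI impI)
  fix p1 assume "H q p" "(p1, p) \<in> r"
  then obtain x t where t: "(x, q) \<in> E" "(t, p1) \<in> r" "(t, x) \<in> le_star r"
    unfolding eval_name_def f_ex_iff generic_def by blast
  then have "(t, t) \<in> r" using le_star_Field r.refl by metis
  then obtain u where "(u, t) \<in> r" "(u, x) \<in> r" using t(3) le_starD by metis
  then show "\<exists>t. (t, p1) \<in> r \<and> (t, q) \<in> E" using t r.trans E_le by blast
next
  assume *: "\<forall>p1. (p1, p) \<in> r \<longrightarrow> (\<exists>t. (t, p1) \<in> r \<and> (t, q) \<in> E)"
  show "H q p"
    unfolding eval_name_def f_ex_iff generic_def
    using * r.le_star_refl by (fastforce intro: FieldI1)
qed

lemma H_E:
  assumes "(p, q) \<in> E"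
  shows "H q p"
proof -
  have p: "p \<in> Field r" using assms E_Field by blast
  show ?thesis unfolding H_iff[OF p]
    using assms E_le r.refl by (blast intro: FieldI1)
qed

lemma H_ex_E:
  assumes "H q p" "p \<in> Field r"
  shows "\<exists>t. (t, p) \<in> r \<and> (t, q) \<in> E"
  using assms H_iff r.refl by metis

lemma H_mono: "H q p \<Longrightarrow> (p', p) \<in> r \<Longrightarrow> H q p'"
  unfolding eval_name_def f_ex_iff by (meson r.trans)

text \<open>Upward closure is \<open>E_mono\<close>. For the other two clauses one moves through
  \<open>s\<close>: \<open>ex_F\<close> gives a condition of \<open>s\<close> below the current one,
  it is shrunk inside \<open>s\<close> (to a common extension, by \<open>FE\<close>, or into the
  dense set), and \<open>ex_E_below\<close> returns to \<open>r\<close>.\<close>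

lemma generic_filter: "p \<in> Field r \<Longrightarrow> f_generic_filter r s H p"
proof -
  have "\<exists>t. (t, p) \<in> r \<and> H q' t" if up: "(q, q') \<in> s" "(p, p0) \<in> r" "H q p" for q q' p p0
  proof -
    have "p \<in> Field r" using up by (blast intro: FieldI1)
    then obtain t where "(t, p) \<in> r" "(t, q) \<in> E" using H_ex_E up by blast
    then show ?thesis using E_mono up(1) H_E r.refl by (meson FieldI1)
  qed
  moreover have "\<exists>t'. (t', p) \<in> r \<and> f_ex r {t. (t, q) \<in> s \<and> (t, q') \<in> s} H t'"
    if both: "(p, p0) \<in> r" "H q p" "H q' p" for p p0 q q'
  proof (intro exI conjI)
    show p: "(p, p) \<in> r" using both(1) r.refl by (blast intro: FieldI1)
    show "f_ex r {t. (t, q) \<in> s \<and> (t, q') \<in> s} H p"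
      unfolding f_ex_iff
    proof (intro allI impI)
      fix p1 assume p1: "(p1, p) \<in> r"
      then obtain p2 where p2: "(p2, p1) \<in> r" "(p2, q) \<in> E"
        using H_ex_E both(2) H_mono by (meson FieldI1)
      then obtain p3 where p3: "(p3, p2) \<in> r" "(p3, q') \<in> E"
        using H_ex_E both(3) H_mono r.trans p1 by (meson FieldI1)
      have p3q: "(p3, q) \<in> E" using p2 p3 E_le by blast
      obtain q0 where q0: "(q0, p3) \<in> F" using ex_F p3 by (meson FieldI1)
      then have "(q0, q0) \<in> s" using F_Field s.refl by blast
      then obtain q1 where q1: "(q1, q0) \<in> s" "(q1, q) \<in> s"
        using FE[OF q0 p3q] le_starD by metis
      obtain q2 where q2: "(q2, q1) \<in> s" "(q2, q') \<in> s"
        using FE[OF q0 p3(2)] q1(1) le_starD by metis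
      have "(q2, p3) \<in> F" using q1 q2 q0 F_le by blast
      then obtain p4 where "(p4, p3) \<in> r" "(p4, q2) \<in> E" using ex_E_below by blast
      moreover from this have "(p4, p1) \<in> r" using p2 p3 r.trans by meson
      moreover have "(q2, q) \<in> s" using q1 q2 s.trans by meson
      ultimately show "\<exists>t\<in>{t. (t, q) \<in> s \<and> (t, q') \<in> s}. \<exists>u. (u, p1) \<in> r \<and> H t u"
        using q2(2) H_E by blast
    qed
  qed
  moreover have "\<exists>d\<in>D. \<exists>t. (t, p) \<in> r \<and> H d t" if D: "dense_in s D" "(p, p0) \<in> r" for D p p0
  proof -
    obtain q where q: "(q, p) \<in> F" using ex_F D(2) by (meson FieldI1)
    then obtain d where d: "d \<in> D" "(d, q) \<in> s"
      using D(1) F_Field unfolding dense_in_def by blast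
    then show ?thesis using ex_E_below F_le q H_E by blast
  qed
  ultimately show ?thesis
    unfolding f_generic_filter_def f_and_def f_all_def f_imp_iff
    by (auto simp: f_ex_iff)
qed

text \<open>The two names are \<open>E\<close> and \<open>F\<close>. If \<open>x\<close> is in G, a
  condition below \<open>x\<close> has an \<open>F\<close>-predecessor that some extension forces
  into \<open>H\<close>; conversely, if \<open>H\<close> contains an \<open>F\<close>-predecessor of
  \<open>x\<close>, then \<open>EF\<close> yields conditions that are \<open>le_star\<close>-below
  \<open>x\<close>.\<close>

lemma ge_subset: "ge_subset r s"
proof -
  have "f_iff r (generic r x) (eval_name r H F x) p" if "x \<in> Field r" for x p
    unfolding f_iff_def f_and_def f_imp_iff
  proof (intro conjI allI impI)
    fix q assume q: "(q, p) \<in> r" "generic r x q"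
    have "eval_name r H F x q"
      unfolding eval_name_def[of r H] f_ex_iff
    proof (intro allI impI)
      fix t1 assume t1: "(t1, q) \<in> r"
      then obtain t2 where t2: "(t2, t1) \<in> r" "(t2, x) \<in> r"
        using q le_starD unfolding generic_def by metis
      then obtain y where y: "(y, t2) \<in> F" using ex_F by (meson FieldI1)
      then obtain t3 where "(t3, t2) \<in> r" "(t3, y) \<in> E" using ex_E_below by blast
      moreover have "(y, x) \<in> F" using y t2 F_mono F_Field s.refl by blast
      ultimately show "\<exists>y\<in>{y. (y, x) \<in> F}. \<exists>t. (t, t1) \<in> r \<and> H y t"
        using t2 H_E r.trans by blast
    qed
    then show "\<exists>t. (t, q) \<in> r \<and> eval_name r H F x t"
      using q(1) r.refl by (meson FieldI1)
  next
    fix q assume q: "(q, p) \<in> r" "eval_name r H F x q"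
    then have "(q, q) \<in> r" using r.refl by (meson FieldI1)
    then obtain y t where "(y, x) \<in> F" "(t, q) \<in> r" "H y t"
      using q(2) unfolding eval_name_def[of r H] f_ex_iff by blast
    moreover then obtain u where "(u, t) \<in> r" "(u, y) \<in> E" using H_ex_E by (meson FieldI1)
    ultimately show "\<exists>t. (t, q) \<in> r \<and> generic r x t"
      unfolding generic_def[of r x] using EF r.trans by blast
  qed
  then have "f_ex r (Pow (Field s \<times> Field r)) (\<lambda>\<pi>.
      f_all (Field r) (\<lambda>x. f_iff r (generic r x) (eval_name r H \<pi> x))) p" for p
    unfolding f_ex_iff f_all_def using F_Field r.refl by (blast intro: FieldI1)
  then show ?thesis
    unfolding ge_subset_def f_ex_iff[of r "Pow (Field r \<times> Field s)"] Let_def f_and_def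
    using E_Field generic_filter r.refl by (blast intro: FieldI1)
qed

end

text \<open>
  If all conditions of \<open>s\<close> are compatible, then a generic filter on \<open>s\<close> contains all of them and
  hence belongs to the ground model.
\<close>

lemma ge_subset_directed:
  assumes "preord r" "preord s" and ge: "ge_subset r s"
    and dir: "\<And>q q'. q \<in> Field s \<Longrightarrow> q' \<in> Field s \<Longrightarrow> \<exists>t. (t, q) \<in> s \<and> (t, q') \<in> s"
    and "p \<in> Field r"
  shows "\<exists>t. (t, p) \<in> r \<and>
    (\<forall>t1 t2. (t1, t) \<in> r \<longrightarrow> (t2, t) \<in> r \<longrightarrow> (\<exists>u. (u, t1) \<in> r \<and> (u, t2) \<in> r))"
proof -
  interpret r: preord r by fact
  interpret s: preord s by fact
  have "(p, p) \<in> r" using assms r.refl by blast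
  moreover have "f_ex r (Pow (Field r \<times> Field s)) (\<lambda>\<tau>.
      let H = eval_name r (generic r) \<tau> in
        f_and (f_generic_filter r s H)
          (f_ex r (Pow (Field s \<times> Field r)) (\<lambda>\<pi>.
            f_all (Field r) (\<lambda>x. f_iff r (generic r x) (eval_name r H \<pi> x))))) p"
    using ge \<open>p \<in> Field r\<close> unfolding ge_subset_def by (rule bspec)
  ultimately have "\<exists>\<tau>\<in>Pow (Field r \<times> Field s). \<exists>t0. (t0, p) \<in> r \<and>
      f_generic_filter r s (eval_name r (generic r) \<tau>) t0 \<and>
      f_ex r (Pow (Field s \<times> Field r)) (\<lambda>\<pi>.
        f_all (Field r) (\<lambda>x. f_iff r (generic r x)
          (eval_name r (eval_name r (generic r) \<tau>) \<pi> x))) t0"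
    unfolding f_ex_iff[of r "Pow (Field r \<times> Field s)"] Let_def f_and_def by (elim allE impE)
  then obtain \<tau> t0 where t0: "(t0, p) \<in> r"
      "f_generic_filter r s (eval_name r (generic r) \<tau>) t0"
      "f_ex r (Pow (Field s \<times> Field r)) (\<lambda>\<pi>.
        f_all (Field r) (\<lambda>x. f_iff r (generic r x)
          (eval_name r (eval_name r (generic r) \<tau>) \<pi> x))) t0"
    by (elim bexE exE conjE)
  define H where "H = eval_name r (generic r) \<tau>"
  have "(t0, t0) \<in> r" using t0 r.refl by (meson FieldI1)
  then have "\<exists>\<pi>\<in>Pow (Field s \<times> Field r). \<exists>t. (t, t0) \<in> r \<and>
      (\<forall>x\<in>Field r. f_iff r (generic r x) (eval_name r H \<pi> x) t)"
    using t0(3) unfolding f_ex_iff[of r "Pow (Field s \<times> Field r)"] f_all_def H_def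
    by (elim allE impE)
  then obtain \<pi> t where t: "(t, t0) \<in> r" "\<pi> \<subseteq> Field s \<times> Field r"
      and iff: "\<And>x. x \<in> Field r \<Longrightarrow> f_iff r (generic r x) (eval_name r H \<pi> x) t"
    by auto
  have up: "\<exists>v. (v, u) \<in> r \<and> H q' v" if "(q, q') \<in> s" "(u, t0) \<in> r" "H q u" for q q' u
    using t0(2) that unfolding f_generic_filter_def f_and_def f_all_def f_imp_iff H_def by blast
  have dense: "\<exists>d\<in>D. \<exists>v. (v, u) \<in> r \<and> H d v" if "dense_in s D" "(u, t0) \<in> r" for D u
    using t0(2) that unfolding f_generic_filter_def f_and_def f_all_def f_ex_iff H_def by blast
  have H: "\<exists>v. (v, u) \<in> r \<and> H q v" if u: "(u, t0) \<in> r" "q \<in> Field s" for u q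
  proof -
    \<comment> \<open>Compatibility of all conditions makes the set below \<open>q\<close> dense, so
      \<open>H\<close> meets it and then contains \<open>q\<close>.\<close>
    have "dense_in s {d. (d, q) \<in> s}"
      unfolding dense_in_def using dir u(2) by (auto intro: FieldI1)
    then obtain d v where "(d, q) \<in> s" "(v, u) \<in> r" "H d v" using dense u(1) by blast
    then show ?thesis using up u(1) r.trans by meson
  qed
  have "\<exists>u. (u, t1) \<in> r \<and> (u, t2) \<in> r" if t1: "(t1, t) \<in> r" and t2: "(t2, t) \<in> r" for t1 t2
  proof -
    have fld: "t1 \<in> Field r" "t2 \<in> Field r" using t1 t2 by (auto intro: FieldI1)
    \<comment> \<open>\<open>t1\<close> forces itself into G, so some \<open>y\<close> is related to
      it by \<pi>. Membership of \<open>y\<close> in \<open>H\<close> can be forced below any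
      condition under \<open>t0\<close>; so \<open>t2\<close> forces \<open>t1\<close> into G as
      well and is therefore compatible with it.\<close>
    have "generic r t1 t1" unfolding generic_def using r.le_star_refl fld by simp
    then obtain v where v: "(v, t1) \<in> r" "eval_name r H \<pi> t1 v"
      using iff[OF fld(1)] t1 unfolding f_iff_def f_and_def f_imp_iff by blast
    then obtain y where y: "(y, t1) \<in> \<pi>" "y \<in> Field s"
      using t(2) r.refl unfolding eval_name_def f_ex_iff by (blast intro: FieldI1)
    have "eval_name r H \<pi> t1 t2"
      unfolding eval_name_def f_ex_iff using y H t2 t(1) r.trans by blast
    then obtain w where w: "(w, t2) \<in> r" "generic r t1 w"
      using iff[OF fld(1)] t2 unfolding f_iff_def f_and_def f_imp_iff by blast
    then have "(w, w) \<in> r" using r.refl by (meson FieldI1)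
    then show ?thesis using w r.trans le_starD unfolding generic_def by metis
  qed
  then show ?thesis using t t0 r.trans by blast
qed

section \<open>Inclusions\<close>

lemma order_isomorphic_iff:
  "order_isomorphic r s \<longleftrightarrow> (\<exists>h. inj_on h (Field r) \<and> s = map_prod h h ` r)"
proof
  assume "order_isomorphic r s"
  then obtain h where h: "bij_betw h (Field r) (Field s)"
      "\<forall>p\<in>Field r. \<forall>q\<in>Field r. (p, q) \<in> r \<longleftrightarrow> (h p, h q) \<in> s"
    unfolding order_isomorphic_def by blast
  have "s = map_prod h h ` r"
  proof (intro equalityI subrelI subsetI)
    fix a b assume ab: "(a, b) \<in> s"
    then obtain p q where "p \<in> Field r" "q \<in> Field r" "a = h p" "b = h q"
      using h(1) unfolding bij_betw_def by (metis FieldI1 FieldI2 imageE)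
    then show "(a, b) \<in> map_prod h h ` r" using h(2) ab by force
  next
    fix x assume "x \<in> map_prod h h ` r"
    then show "x \<in> s" using h(2) by (auto intro: FieldI1 FieldI2)
  qed
  then show "\<exists>h. inj_on h (Field r) \<and> s = map_prod h h ` r"
    using h(1) bij_betw_def by blast
next
  assume "\<exists>h. inj_on h (Field r) \<and> s = map_prod h h ` r"
  then obtain h where h: "inj_on h (Field r)" "s = map_prod h h ` r" by blast
  have "Field s = h ` Field r" unfolding h(2) Field_def by force
  moreover have "(p, q) \<in> r \<longleftrightarrow> (h p, h q) \<in> s" if "p \<in> Field r" "q \<in> Field r" for p q
  proof
    assume "(h p, h q) \<in> s"
    then obtain p' q' where "(p', q') \<in> r" "h p = h p'" "h q = h q'" unfolding h(2) by auto
    moreover from this have "p = p'" "q = q'"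
      using h(1) that by (auto intro: FieldI1 FieldI2 dest: inj_onD)
    ultimately show "(p, q) \<in> r" by simp
  qed (force simp: h(2))
  ultimately show "order_isomorphic r s"
    unfolding order_isomorphic_def bij_betw_def using h(1) by blast
qed

lemma order_isomorphic_refl: "order_isomorphic r r"
  unfolding order_isomorphic_iff by (rule exI[of _ id]) (simp add: map_prod.id)

lemma le_star_iso:
  assumes "inj_on h (Field r)" "s = map_prod h h ` r"
  shows "le_star s = map_prod h h ` le_star r"
proof -
  have s: "(h p, h q) \<in> s \<longleftrightarrow> (p, q) \<in> r" if "p \<in> Field r" "q \<in> Field r" for p q
  proof
    assume "(h p, h q) \<in> s"
    then obtain p' q' where pq: "(p', q') \<in> r" "h p = h p'" "h q = h q'" unfolding assms(2) by auto
    then have "p = p'" "q = q'"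
      using that FieldI1[OF pq(1)] FieldI2[OF pq(1)] inj_onD[OF assms(1)] by blast+
    then show "(p, q) \<in> r" using pq by simp
  qed (force simp: assms(2))
  have fld: "Field s = h ` Field r" unfolding assms(2) Field_def by force
  have s_ex: "\<exists>x\<in>Field r. a = h x \<and> (x, p) \<in> r" if "(a, h p) \<in> s" "p \<in> Field r" for a p
    using that s fld by (metis FieldI1 imageE)
  have "(h p, h q) \<in> le_star s \<longleftrightarrow> (p, q) \<in> le_star r" if pq: "p \<in> Field r" "q \<in> Field r" for p q
  proof
    assume *: "(h p, h q) \<in> le_star s"
    show "(p, q) \<in> le_star r"
    proof (rule le_starI[OF pq])
      fix t assume t: "(t, p) \<in> r"
      then have tF: "t \<in> Field r" by (rule FieldI1)
      then have "(h t, h p) \<in> s" using t s pq by blast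
      then obtain a where a: "(a, h t) \<in> s" "(a, h q) \<in> s" using * le_starD by metis
      then obtain x where "x \<in> Field r" "a = h x" "(x, t) \<in> r" using s_ex tF by blast
      then show "\<exists>x. (x, t) \<in> r \<and> (x, q) \<in> r" using a(2) s pq by blast
    qed
  next
    assume *: "(p, q) \<in> le_star r"
    show "(h p, h q) \<in> le_star s"
    proof (rule le_starI)
      show "h p \<in> Field s" "h q \<in> Field s" using fld pq by auto
      fix a assume "(a, h p) \<in> s"
      then obtain t where t: "t \<in> Field r" "a = h t" "(t, p) \<in> r" using s_ex pq by blast
      then obtain x where x: "(x, t) \<in> r" "(x, q) \<in> r" using * le_starD by metis
      then have "(h x, h t) \<in> s \<and> (h x, h q) \<in> s" using t s pq FieldI1 by metis
      then show "\<exists>b. (b, a) \<in> s \<and> (b, h q) \<in> s" using t by blast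
    qed
  qed
  note iff = this
  show ?thesis
  proof (intro equalityI subrelI subsetI)
    fix a b assume ab: "(a, b) \<in> le_star s"
    then obtain p q where "p \<in> Field r" "q \<in> Field r" "a = h p" "b = h q"
      using fld le_star_Field[OF ab] by blast
    then show "(a, b) \<in> map_prod h h ` le_star r" using ab iff by auto
  next
    fix x assume "x \<in> map_prod h h ` le_star r"
    then obtain p q where pq: "(p, q) \<in> le_star r" "x = (h p, h q)" by auto
    then show "x \<in> le_star s" using iff le_star_Field[OF pq(1)] by simp
  qed
qed

text \<open>The isomorphism \<open>h\<close> acts on classes by images. Classes are subsets of
  \<open>Field r\<close>, where \<open>h\<close> is injective, so distinct classes have distinct
  images.\<close>

lemma sq_iso:
  assumes "order_isomorphic r s"
  shows "order_isomorphic (sq r) (sq s)"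
proof -
  obtain h where h: "inj_on h (Field r)" "s = map_prod h h ` r"
    using assms unfolding order_isomorphic_iff by blast
  note le = le_star_iso[OF h]
  have eq: "eq_star s `` {h p} = h ` (eq_star r `` {p})" if "p \<in> Field r" for p
  proof (intro set_eqI iffI)
    fix a assume "a \<in> eq_star s `` {h p}"
    then have a: "(h p, a) \<in> le_star s" "(a, h p) \<in> le_star s" by (auto simp: eq_star_def)
    obtain p1 x where 1: "(p1, x) \<in> le_star r" "h p = h p1" "a = h x" using a(1) le by auto
    obtain p2 x' where 2: "(x', p2) \<in> le_star r" "h p = h p2" "a = h x'" using a(2) le by auto
    note F = le_star_Field[OF 1(1)] le_star_Field[OF 2(1)]
    have "p1 = p" "p2 = p" "x' = x"
      using that F inj_onD[OF h(1) 1(2)] inj_onD[OF h(1) 2(2)] inj_onD[OF h(1), of x' x] 1(3) 2(3)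
      by simp_all
    then have "(p, x) \<in> eq_star r" using 1(1) 2(1) by (simp add: eq_star_def)
    then show "a \<in> h ` (eq_star r `` {p})" using 1(3) by blast
  next
    fix a assume "a \<in> h ` (eq_star r `` {p})"
    then obtain x where "a = h x" "(p, x) \<in> le_star r" "(x, p) \<in> le_star r"
      unfolding eq_star_def by auto
    then show "a \<in> eq_star s `` {h p}" unfolding eq_star_def le by force
  qed
  have "sq s = map_prod (image h) (image h) ` sq r"
  proof (intro equalityI subrelI subsetI)
    fix A B assume "(A, B) \<in> sq s"
    then obtain p q where pq: "(p, q) \<in> le_star r"
        "A = eq_star s `` {h p}" "B = eq_star s `` {h q}"
      unfolding sq_def le by auto
    then show "(A, B) \<in> map_prod (image h) (image h) ` sq r"
      using eq le_star_Field[OF pq(1)] unfolding sq_def by auto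
  next
    fix x assume "x \<in> map_prod (image h) (image h) ` sq r"
    then obtain A B where AB: "(A, B) \<in> sq r" "x = (h ` A, h ` B)" by auto
    then obtain p q where pq: "(p, q) \<in> le_star r" "A = eq_star r `` {p}" "B = eq_star r `` {q}"
      unfolding sq_def by blast
    then have "(h p, h q) \<in> le_star s" unfolding le by force
    moreover have "h ` A = eq_star s `` {h p}" "h ` B = eq_star s `` {h q}"
      using pq eq le_star_Field[OF pq(1)] by auto
    ultimately show "x \<in> sq s" using AB(2) unfolding sq_def by auto
  qed
  moreover have "inj_on (image h) (Field (sq r))"
  proof (rule inj_on_subset[OF inj_on_image_Pow[OF h(1)]])
    have "eq_star r `` {p} \<subseteq> Field r" for p
      unfolding eq_star_def using le_star_Field[of p] by auto
    then show "Field (sq r) \<subseteq> Pow (Field r)"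
      using Field_sq_subset[of r] by blast
  qed
  ultimately show ?thesis unfolding order_isomorphic_iff by blast
qed

lemma order_isomorphic_sym:
  assumes "order_isomorphic r s"
  shows "order_isomorphic s r"
proof -
  obtain h where bij: "bij_betw h (Field r) (Field s)"
    and h: "\<And>p q. p \<in> Field r \<Longrightarrow> q \<in> Field r \<Longrightarrow> (p, q) \<in> r \<longleftrightarrow> (h p, h q) \<in> s"
    using assms unfolding order_isomorphic_def by blast
  let ?g = "inv_into (Field r) h"
  note g = bij_betw_inv_into[OF bij]
  have "(a, b) \<in> s \<longleftrightarrow> (?g a, ?g b) \<in> r" if "a \<in> Field s" "b \<in> Field s" for a b
    using that h[of "?g a" "?g b"] bij_betw_apply[OF g] bij_betw_inv_into_right[OF bij] by simp
  then show ?thesis unfolding order_isomorphic_def using g by blast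
qed

lemma order_isomorphic_trans:
  assumes "order_isomorphic r s" "order_isomorphic s t"
  shows "order_isomorphic r t"
proof -
  obtain f where f: "bij_betw f (Field r) (Field s)"
      "\<And>p q. p \<in> Field r \<Longrightarrow> q \<in> Field r \<Longrightarrow> (p, q) \<in> r \<longleftrightarrow> (f p, f q) \<in> s"
    using assms(1) unfolding order_isomorphic_def by blast
  obtain g where g: "bij_betw g (Field s) (Field t)"
      "\<And>p q. p \<in> Field s \<Longrightarrow> q \<in> Field s \<Longrightarrow> (p, q) \<in> s \<longleftrightarrow> (g p, g q) \<in> t"
    using assms(2) unfolding order_isomorphic_def by blast
  have "(p, q) \<in> r \<longleftrightarrow> ((g \<circ> f) p, (g \<circ> f) q) \<in> t" if "p \<in> Field r" "q \<in> Field r" for p q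
    using f(2) g(2) that bij_betw_apply[OF f(1)] by simp
  then show ?thesis
    unfolding order_isomorphic_def using bij_betw_trans[OF f(1) g(1)] by blast
qed

lemma order_isomorphic_cong:
  assumes "order_isomorphic r r'" "order_isomorphic s s'"
  shows "order_isomorphic r s \<longleftrightarrow> order_isomorphic r' s'"
proof
  assume "order_isomorphic r s"
  from order_isomorphic_trans[OF order_isomorphic_sym[OF assms(1)] order_isomorphic_trans[OF this assms(2)]]
  show "order_isomorphic r' s'" .
next
  assume "order_isomorphic r' s'"
  from order_isomorphic_trans[OF assms(1) order_isomorphic_trans[OF this order_isomorphic_sym[OF assms(2)]]]
  show "order_isomorphic r s" .
qed

text \<open>A choice of representatives turns the isomorphism into a map \<open>m\<close> on
  conditions that preserves and reflects \<open>le_star\<close> and meets every class of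
  \<open>s\<close>. As \<open>m\<close> is determined only up to \<open>eq_star\<close>, the two
  relations are built from \<open>le_star\<close> and not from the order itself.\<close>

lemma sq_iso_ge_subset:
  assumes "preord r" "preord s" and iso: "order_isomorphic (sq r) (sq s)"
  shows "ge_subset r s"
proof -
  interpret r: preord r by fact
  interpret s: preord s by fact
  obtain \<phi> where bij: "bij_betw \<phi> (Field (sq r)) (Field (sq s))"
    and \<phi>: "\<And>A B. A \<in> Field (sq r) \<Longrightarrow> B \<in> Field (sq r) \<Longrightarrow> (A, B) \<in> sq r \<longleftrightarrow> (\<phi> A, \<phi> B) \<in> sq s"
    using iso unfolding order_isomorphic_def by blast
  let ?c = "\<lambda>p. eq_star r `` {p}" and ?d = "\<lambda>q. eq_star s `` {q}"
  have "\<exists>q. q \<in> Field s \<and> \<phi> (?c p) = ?d q" if "p \<in> Field r" for p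
    using bij_betw_apply[OF bij, of "?c p"] that unfolding r.Field_sq s.Field_sq by blast
  then obtain m where m: "\<And>p. p \<in> Field r \<Longrightarrow> m p \<in> Field s \<and> \<phi> (?c p) = ?d (m p)"
    by metis
  have m_le: "(m p, m p') \<in> le_star s \<longleftrightarrow> (p, p') \<in> le_star r"
    if "p \<in> Field r" "p' \<in> Field r" for p p'
    using that \<phi>[of "?c p" "?c p'"] m r.sq_iff s.sq_iff by (simp add: r.Field_sq)
  have m_surj: "\<exists>p\<in>Field r. (q, m p) \<in> le_star s \<and> (m p, q) \<in> le_star s" if q: "q \<in> Field s" for q
  proof -
    have "?d q \<in> \<phi> ` ?c ` Field r"
      using bij q unfolding bij_betw_def r.Field_sq s.Field_sq by blast
    then obtain p where p: "p \<in> Field r" "?d q = ?d (m p)" using m by auto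
    then have "(q, m p) \<in> eq_star s" using s.eq_star_class_eq_iff q by blast
    then show ?thesis using p(1) unfolding eq_star_def by blast
  qed
  interpret ge_pair r s "{(p, q). p \<in> Field r \<and> (m p, q) \<in> le_star s}"
      "{(q, p). p \<in> Field r \<and> (q, m p) \<in> le_star s}"
  proof
    fix p q p' assume *: "(p, q) \<in> {(p, q). p \<in> Field r \<and> (m p, q) \<in> le_star s}"
      "(q, p') \<in> {(q, p). p \<in> Field r \<and> (q, m p) \<in> le_star s}"
    then have "(m p, m p') \<in> le_star s" using s.le_star_trans by blast
    then show "(p, p') \<in> le_star r" using * m_le by blast
  next
    fix p' p q q' assume *: "(p', p) \<in> r" "(p, q) \<in> {(p, q). p \<in> Field r \<and> (m p, q) \<in> le_star s}"
      "(q, q') \<in> s"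
    then have F: "p' \<in> Field r" "p \<in> Field r" by (auto intro: FieldI1)
    then have "(m p', m p) \<in> le_star s" using m_le r.le_star * by blast
    then show "(p', q') \<in> {(p, q). p \<in> Field r \<and> (m p, q) \<in> le_star s}"
      using * F s.le_star s.le_star_trans by blast
  next
    fix q' q p p' assume *: "(q', q) \<in> s" "(q, p) \<in> {(q, p). p \<in> Field r \<and> (q, m p) \<in> le_star s}"
      "(p, p') \<in> r"
    then have F: "p' \<in> Field r" "p \<in> Field r" by (auto intro: FieldI2)
    then have "(m p, m p') \<in> le_star s" using m_le r.le_star * by blast
    then show "(q', p') \<in> {(q, p). p \<in> Field r \<and> (q, m p) \<in> le_star s}"
      using * F s.le_star s.le_star_trans by blast
  next
    fix q p q' assume "(q, p) \<in> {(q, p). p \<in> Field r \<and> (q, m p) \<in> le_star s}"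
      "(p, q') \<in> {(p, q). p \<in> Field r \<and> (m p, q) \<in> le_star s}"
    then show "(q, q') \<in> le_star s" using s.le_star_trans by blast
  next
    fix p assume "p \<in> Field r"
    then show "\<exists>q. (q, p) \<in> {(q, p). p \<in> Field r \<and> (q, m p) \<in> le_star s}"
      using m s.le_star_refl by blast
  next
    fix q p assume "(q, p) \<in> {(q, p). p \<in> Field r \<and> (q, m p) \<in> le_star s}"
    then have "q \<in> Field s" using le_star_Field[of q "m p" s] by simp
    then show "\<exists>p'. (p', q) \<in> {(p, q). p \<in> Field r \<and> (m p, q) \<in> le_star s}" using m_surj by blast
  qed (auto dest: le_star_Field)
  show ?thesis by (rule ge_subset)
qed

lemma sq_iso_forcing_equivalent:
  assumes "preord r" "preord s" "order_isomorphic (sq r) (sq s)"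
  shows "forcing_equivalent r s"
  unfolding forcing_equivalent_def
  using sq_iso_ge_subset[OF assms]
    sq_iso_ge_subset[OF assms(2,1) order_isomorphic_sym[OF assms(3)]] by (rule conjI)

section \<open>Embeddings and posets of copies\<close>

lemma map_tuples:
  "f ` X \<subseteq> Y \<Longrightarrow> xs \<in> tuples X n \<Longrightarrow> map f xs \<in> tuples Y n"
  unfolding tuples_def by auto

lemma embedding_id: "embedding L S S id"
  unfolding embedding_def by simp

lemma embedding_subset: "embedding L S T f \<Longrightarrow> f ` fst S \<subseteq> fst T"
  unfolding embedding_def by blast

lemma embedding_inj: "embedding L S T f \<Longrightarrow> inj_on f (fst S)"
  unfolding embedding_def by blast

lemma embedding_comp:
  assumes "embedding L R S f" "embedding L S T g"
  shows "embedding L R T (g \<circ> f)"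
proof -
  have "xs \<in> snd R i \<longleftrightarrow> map (g \<circ> f) xs \<in> snd T i"
    if "i \<in> dom L" "xs \<in> tuples (fst R) (the (L i))" for i xs
    using assms that map_tuples[OF embedding_subset[OF assms(1)] that(2)]
    unfolding embedding_def by (metis map_map)
  moreover have "inj_on (g \<circ> f) (fst R)"
    using assms comp_inj_on inj_on_subset unfolding embedding_def by metis
  moreover have "(g \<circ> f) ` fst R \<subseteq> fst T"
    using embedding_subset[OF assms(1)] embedding_subset[OF assms(2)] by auto
  ultimately show ?thesis unfolding embedding_def by blast
qed

text \<open>Embeddings reflect relations, so \<open>k\<close> may be pulled back along
  \<open>f\<close>. With the identity as \<open>k\<close> this inverts isomorphisms; in general it
  finds copies of S inside the range of \<open>f\<close>.\<close>

lemma embedding_factor: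
  assumes k: "embedding L R T k" and f: "embedding L S T f" and sub: "k ` fst R \<subseteq> f ` fst S"
  shows "embedding L R S (inv_into (fst S) f \<circ> k)"
proof -
  let ?h = "inv_into (fst S) f \<circ> k"
  have fh: "f (?h x) = k x" if "x \<in> fst R" for x
    using that sub by (auto intro!: f_inv_into_f)
  have h: "?h ` fst R \<subseteq> fst S" using sub by (auto intro!: inv_into_into)
  have "inj_on ?h (fst R)" using fh embedding_inj[OF k] unfolding inj_on_def by metis
  moreover have "xs \<in> snd R i \<longleftrightarrow> map ?h xs \<in> snd S i"
    if i: "i \<in> dom L" "xs \<in> tuples (fst R) (the (L i))" for i xs
  proof -
    have "map f (map ?h xs) = map k xs"
      unfolding map_map using i fh by (intro map_cong) (auto simp: tuples_def)
    then show ?thesis using k f i map_tuples[OF h i(2)] unfolding embedding_def by metis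
  qed
  ultimately show ?thesis using h unfolding embedding_def by blast
qed

lemma isomorphic_inverse:
  assumes "embedding L S T f" "f ` fst S = fst T"
  shows "embedding L T S (inv_into (fst S) f)"
  using embedding_factor[OF embedding_id assms(1)] assms(2) by simp

lemma isomorphic_imp_equimorphic: "isomorphic L S T \<Longrightarrow> equimorphic L S T"
  unfolding isomorphic_def equimorphic_def using isomorphic_inverse by metis

lemma equimorphic_sym: "equimorphic L S T \<Longrightarrow> equimorphic L T S"
  unfolding equimorphic_def by blast

lemma copiesI: "embedding L S S f \<Longrightarrow> f ` fst S \<in> copies L S"
  unfolding copies_def by blast

lemma copiesE:
  assumes "C \<in> copies L S"
  obtains f where "embedding L S S f" "C = f ` fst S"
  using assms unfolding copies_def by blast

lemma copies_subset: "C \<in> copies L S \<Longrightarrow> C \<subseteq> fst S"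
  unfolding copies_def using embedding_subset by blast

lemma image_copies_mono_iff:
  assumes "embedding L S T f" "C \<in> copies L S" "D \<in> copies L S"
  shows "f ` C \<subseteq> f ` D \<longleftrightarrow> C \<subseteq> D"
  using embedding_inj[OF assms(1)] copies_subset[OF assms(2)] copies_subset[OF assms(3)]
  unfolding inj_on_def by blast

lemma copies_order_iff:
  "(C, D) \<in> copies_order L S \<longleftrightarrow> C \<in> copies L S \<and> D \<in> copies L S \<and> C \<subseteq> D"
  unfolding copies_order_def relation_of_def by simp

lemma Field_copies_order [simp]: "Field (copies_order L S) = copies L S"
  unfolding Field_def by (auto simp: copies_order_iff)

lemma preord_copies_order: "preord (copies_order L S)"
  by standard (auto simp: copies_order_iff)

text \<open>Conjugation by the isomorphism turns self-embeddings of one structure into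
  self-embeddings of the other.\<close>

lemma isomorphic_imp_order_isomorphic:
  assumes "isomorphic L S T"
  shows "order_isomorphic (copies_order L S) (copies_order L T)"
proof -
  obtain f where f: "embedding L S T f" "f ` fst S = fst T"
    using assms unfolding isomorphic_def by blast
  let ?g = "inv_into (fst S) f"
  note g = isomorphic_inverse[OF f]
  have fg: "f ` ?g ` A = A" if "A \<subseteq> fst T" for A
    using image_inv_into_cancel[OF f(2) that] .
  have gf: "?g ` f ` A = A" if "A \<subseteq> fst S" for A
    using inv_into_image_cancel[OF embedding_inj[OF f(1)] that] .
  have copy: "f ` C \<in> copies L T" if C: "C \<in> copies L S" for C
  proof -
    obtain c where "embedding L S S c" "C = c ` fst S" using C unfolding copies_def by blast
    moreover from this have "embedding L T T (f \<circ> c \<circ> ?g)"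
      using embedding_comp[OF g embedding_comp[OF _ f(1)]] by simp
    moreover have "?g ` fst T = fst S" using gf[of "fst S"] f(2) by simp
    ultimately have "embedding L T T (f \<circ> c \<circ> ?g)" "f ` C = (f \<circ> c \<circ> ?g) ` fst T"
      by (simp_all only: image_comp[symmetric])
    then show ?thesis unfolding copies_def by blast
  qed
  have surj: "D \<in> (`) f ` copies L S" if D: "D \<in> copies L T" for D
  proof -
    obtain d where d: "embedding L T T d" "D = d ` fst T" using D unfolding copies_def by blast
    have "embedding L S S (?g \<circ> d \<circ> f)"
      using embedding_comp[OF f(1) embedding_comp[OF d(1) g]] by (simp only: comp_assoc)
    then have "(?g \<circ> d \<circ> f) ` fst S \<in> copies L S" by (rule copiesI)
    moreover have "(?g \<circ> d \<circ> f) ` fst S = ?g ` D" using d f(2)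
      by (simp only: image_comp[symmetric])
    ultimately have "?g ` D \<in> copies L S" by simp
    then show ?thesis using fg[OF copies_subset[OF D]] by (metis imageI)
  qed
  have inj: "f ` C \<subseteq> f ` D \<longleftrightarrow> C \<subseteq> D" if "C \<in> copies L S" "D \<in> copies L S" for C D
    using image_copies_mono_iff[OF f(1) that] .
  show ?thesis
    unfolding order_isomorphic_def
  proof (intro exI conjI ballI)
    have "inj_on (image f) (copies L S)" unfolding inj_on_def using inj by (metis subset_antisym subset_refl)
    then show "bij_betw (image f) (Field (copies_order L S)) (Field (copies_order L T))"
      unfolding bij_betw_def using copy surj by auto
  qed (use inj copy in \<open>auto simp: copies_order_iff\<close>)
qed

lemma equimorphic_imp_ge_subset:
  assumes "equimorphic L S T"
  shows "ge_subset (copies_order L S) (copies_order L T)"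
proof -
  obtain f g where f: "embedding L S T f" and g: "embedding L T S g"
    using assms unfolding equimorphic_def by blast
  note le = preord.le_star[OF preord_copies_order]
  interpret preord "copies_order L S" by (rule preord_copies_order)
  interpret ge_pair "copies_order L S" "copies_order L T"
    "{(C, D). C \<in> copies L S \<and> D \<in> copies L T \<and> f ` C \<subseteq> D}"
    "{(D, C). C \<in> copies L S \<and> D \<in> copies L T \<and> D \<subseteq> f ` C}"
  proof (unfold_locales, goal_cases)
    case (7 C D C')
    then have "f ` C \<subseteq> f ` C'" by blast
    then show ?case
      using 7 image_copies_mono_iff[OF f, of C C'] by (intro le) (simp add: copies_order_iff)
  next
    case (8 D C D')
    then show ?case by (intro le) (auto simp: copies_order_iff)
  next
    case (9 C)
    then obtain c where "embedding L S S c" "C = c ` fst S" by (auto elim: copiesE)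
    \<comment> \<open>Going through S produces a copy of T inside f[C].\<close>
    then have "embedding L T T (f \<circ> c \<circ> g)" "(f \<circ> c \<circ> g) ` fst T \<subseteq> f ` C"
      using embedding_comp[OF embedding_comp[OF g] f] embedding_subset[OF g]
      by (auto simp: comp_assoc)
    then show ?case using 9 copiesI[of L T "f \<circ> c \<circ> g"] by auto
  next
    case (10 D C)
    then obtain d where d: "embedding L T T d" "D = d ` fst T" by (auto elim: copiesE)
    \<comment> \<open>An arbitrary copy D of T need not contain the f-image of a copy of S, which is
      why \<open>ex_E\<close> speaks only of D inside some f[C]. For such D the range of
      \<open>d \<circ> f\<close> lies in the range of \<open>f\<close> and can be pulled
      back.\<close>
    have "embedding L S T (d \<circ> f)" using d embedding_comp[OF f] by simp
    moreover have sub: "(d \<circ> f) ` fst S \<subseteq> f ` fst S"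
    proof -
      have "(d \<circ> f) ` fst S \<subseteq> D" using d embedding_subset[OF f] by auto
      moreover have "D \<subseteq> f ` C" "C \<subseteq> fst S" using 10 by (auto dest: copies_subset)
      ultimately show ?thesis by blast
    qed
    ultimately have h: "embedding L S S (inv_into (fst S) f \<circ> (d \<circ> f))"
      by (rule embedding_factor[OF _ f])
    have "f ` (inv_into (fst S) f \<circ> (d \<circ> f)) ` fst S = (d \<circ> f) ` fst S"
      using image_inv_into_cancel[OF HOL.refl sub] by (simp only: image_comp[symmetric])
    also have "\<dots> \<subseteq> D" using d embedding_subset[OF f] by auto
    finally show ?case using copiesI[OF h] 10 by auto
  qed (auto simp: copies_order_iff)
  show ?thesis by (rule ge_subset)
qed

lemma equimorphic_imp_forcing_equivalent:
  "equimorphic L S T \<Longrightarrow> forcing_equivalent (copies_order L S) (copies_order L T)"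
  unfolding forcing_equivalent_def
  using equimorphic_imp_ge_subset equimorphic_sym by metis

section \<open>The fifteen inclusions and the reduction to seven non-inclusions\<close>

lemma sim_mono:
  assumes "(k, l) \<in> basic_pairs" "sim k A B"
  shows "sim l A B"
proof -
  obtain X L1 Y L2 where AB: "A = (X, L1)" "B = (Y, L2)" by fastforce
  note P = preord_copies_order[of L1 X] preord_copies_order[of L2 Y]
  note facts = isomorphic_imp_equimorphic[of L1 X Y] isomorphic_imp_order_isomorphic[of L1 X Y]
    sq_iso[of "copies_order L1 X" "copies_order L2 Y"]
    sq_iso_forcing_equivalent[OF P] equimorphic_imp_forcing_equivalent[of L1 X Y]
  have "isomorphic L1 X X"
    unfolding isomorphic_def using embedding_id by (metis image_id id_apply)
  moreover have "copies L1 X = copies L2 Y \<Longrightarrow>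
      order_isomorphic (copies_order L1 X) (copies_order L2 Y)"
    using order_isomorphic_refl by (simp add: copies_order_def)
  ultimately show ?thesis
    using assms facts unfolding basic_pairs_def sim_def AB Let_def
    by (elim insertE emptyE) auto
qed

text \<open>By \<open>basic\<close>, an inclusion \<open>R k \<subseteq> R l\<close> gives one from
  anything below \<open>k\<close> to anything above \<open>l\<close>. So each of the seven
  hypotheses excludes a whole rectangle of pairs, and the seven rectangles exhaust the pairs outside
  the closure.\<close>

lemma hierarchyI:
  assumes basic: "\<And>k l. (k, l) \<in> basic_pairs \<Longrightarrow> R k \<subseteq> R l"
    and neg: "\<not> R 1 \<subseteq> R 0" "\<not> R 2 \<subseteq> R 3" "\<not> R 3 \<subseteq> R 4" "\<not> R 4 \<subseteq> R 9" "\<not> R 7 \<subseteq> R 6" "\<not> R 9 \<subseteq> R 8" "\<not> R 11 \<subseteq> R 10"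
  shows "hierarchy R"
proof -
  let ?C = "basic_pairs\<^sup>*"
  \<comment> \<open>The upper sets of the generated order are computed from the top down. A node
    with a single successor uses it both as \<open>m\<close> and as \<open>n\<close>.\<close>
  have step: "\<forall>l\<in>insert k (A \<union> B). (k, l) \<in> ?C"
    if "(k, m) \<in> basic_pairs" "(k, n) \<in> basic_pairs"
      "\<forall>l\<in>A. (m, l) \<in> ?C" "\<forall>l\<in>B. (n, l) \<in> ?C" for k m n A B
    using that by (blast intro: converse_rtrancl_into_rtrancl)
  have up11: "\<forall>l\<in>{11}. (11, l) \<in> ?C" by simp
  have up10: "\<forall>l\<in>{10, 11}. (10, l) \<in> ?C"
    using step[OF _ _ up11 up11, of 10] by (simp add: basic_pairs_def)
  have up9: "\<forall>l\<in>{9, 10, 11}. (9, l) \<in> ?C"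
    using step[OF _ _ up10 up10, of 9] by (simp add: basic_pairs_def)
  have up8: "\<forall>l\<in>{8, 10, 11}. (8, l) \<in> ?C"
    using step[OF _ _ up10 up10, of 8] by (simp add: basic_pairs_def)
  have up7: "\<forall>l\<in>{7, 8, 9, 10, 11}. (7, l) \<in> ?C"
    using step[OF _ _ up8 up9, of 7] by (simp add: basic_pairs_def)
  have up6: "\<forall>l\<in>{6, 8, 10, 11}. (6, l) \<in> ?C"
    using step[OF _ _ up8 up8, of 6] by (simp add: basic_pairs_def)
  have up5: "\<forall>l\<in>{5, 6, 7, 8, 9, 10, 11}. (5, l) \<in> ?C"
    using step[OF _ _ up6 up7, of 5] by (simp add: basic_pairs_def)
  have up4: "\<forall>l\<in>{4, 6, 8, 10, 11}. (4, l) \<in> ?C"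
    using step[OF _ _ up6 up6, of 4] by (simp add: basic_pairs_def)
  have up3: "\<forall>l\<in>{3, 5, 6, 7, 8, 9, 10, 11}. (3, l) \<in> ?C"
    using step[OF _ _ up5 up5, of 3] by (simp add: basic_pairs_def)
  have up2: "\<forall>l\<in>{2, 4, 5, 6, 7, 8, 9, 10, 11}. (2, l) \<in> ?C"
    using step[OF _ _ up4 up5, of 2] by (simp add: basic_pairs_def)
  have up1: "\<forall>l\<in>{1, 2, 3, 4, 5, 6, 7, 8, 9, 10, 11}. (1, l) \<in> ?C"
    using step[OF _ _ up2 up3, of 1] by (simp add: basic_pairs_def)
  have up0: "\<forall>l\<in>{0, 1, 2, 3, 4, 5, 6, 7, 8, 9, 10, 11}. (0, l) \<in> ?C"
    using step[OF _ _ up1 up1, of 0] by (simp add: basic_pairs_def)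
  have mono: "R k \<subseteq> R l" if "(k, l) \<in> ?C" for k l
    using that by induction (use basic in blast)+
  have neg': "\<forall>k\<in>K. \<forall>l\<in>M. \<not> R k \<subseteq> R l"
    if "\<not> R k' \<subseteq> R l'" "\<forall>k\<in>K. (k', k) \<in> ?C" "\<forall>l\<in>M. (l, l') \<in> ?C" for K M k' l'
    using that mono by (meson subset_trans)
  have no1: "\<forall>k\<in>{1, 2, 3, 4, 5, 6, 7, 8, 9, 10, 11}. \<forall>l\<in>{0}. \<not> R k \<subseteq> R l"
    by (rule neg'[OF neg(1) up1]) (use up0 in simp)
  have no2: "\<forall>k\<in>{2, 4, 5, 6, 7, 8, 9, 10, 11}. \<forall>l\<in>{0, 1, 3}. \<not> R k \<subseteq> R l"
    by (rule neg'[OF neg(2) up2]) (use up0 up1 up3 in simp)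
  have no3: "\<forall>k\<in>{3, 5, 6, 7, 8, 9, 10, 11}. \<forall>l\<in>{0, 1, 2, 4}. \<not> R k \<subseteq> R l"
    by (rule neg'[OF neg(3) up3]) (use up0 up1 up2 up4 in simp)
  have no4: "\<forall>k\<in>{4, 6, 8, 10, 11}. \<forall>l\<in>{0, 1, 2, 3, 5, 7, 9}. \<not> R k \<subseteq> R l"
    by (rule neg'[OF neg(4) up4]) (use up0 up1 up2 up3 up5 up7 up9 in simp)
  have no5: "\<forall>k\<in>{7, 8, 9, 10, 11}. \<forall>l\<in>{0, 1, 2, 3, 4, 5, 6}. \<not> R k \<subseteq> R l"
    by (rule neg'[OF neg(5) up7]) (use up0 up1 up2 up3 up4 up5 up6 in simp)
  have no6: "\<forall>k\<in>{9, 10, 11}. \<forall>l\<in>{0, 1, 2, 3, 4, 5, 6, 7, 8}. \<not> R k \<subseteq> R l"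
    by (rule neg'[OF neg(6) up9]) (use up0 up1 up2 up3 up4 up5 up6 up7 up8 in simp)
  have no7: "\<forall>k\<in>{11}. \<forall>l\<in>{0, 1, 2, 3, 4, 5, 6, 7, 8, 9, 10}. \<not> R k \<subseteq> R l"
    by (rule neg'[OF neg(7) up11]) (use up0 up1 up2 up3 up4 up5 up6 up7 up8 up9 up10 in simp)
  have "(k, l) \<in> ?C" if "k \<le> 11" "l \<le> 11" "R k \<subseteq> R l" for k l
  proof -
    have range: "n \<le> 11 \<Longrightarrow> n \<in> {0, 1, 2, 3, 4, 5, 6, 7, 8, 9, 10, 11}" for n :: nat
      unfolding insert_iff empty_iff by presburger
    show ?thesis
      using range[OF that(1)]
    proof (elim insertE emptyE)
      assume k: "k = 0"
      then have "l \<in> {0, 1, 2, 3, 4, 5, 6, 7, 8, 9, 10, 11}"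
        using range[OF that(2)] that(3)  by (elim insertE emptyE) auto
      then show ?thesis using up0 k by blast
    next
      assume k: "k = 1"
      then have "l \<in> {1, 2, 3, 4, 5, 6, 7, 8, 9, 10, 11}"
        using range[OF that(2)] that(3) no1 by (elim insertE emptyE) auto
      then show ?thesis using up1 k by blast
    next
      assume k: "k = 2"
      then have "l \<in> {2, 4, 5, 6, 7, 8, 9, 10, 11}"
        using range[OF that(2)] that(3) no1 no2 by (elim insertE emptyE) auto
      then show ?thesis using up2 k by blast
    next
      assume k: "k = 3"
      then have "l \<in> {3, 5, 6, 7, 8, 9, 10, 11}"
        using range[OF that(2)] that(3) no1 no3 by (elim insertE emptyE) auto
      then show ?thesis using up3 k by blast
    next
      assume k: "k = 4"
      then have "l \<in> {4, 6, 8, 10, 11}"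
        using range[OF that(2)] that(3) no1 no2 no4 by (elim insertE emptyE) auto
      then show ?thesis using up4 k by blast
    next
      assume k: "k = 5"
      then have "l \<in> {5, 6, 7, 8, 9, 10, 11}"
        using range[OF that(2)] that(3) no1 no2 no3 by (elim insertE emptyE) auto
      then show ?thesis using up5 k by blast
    next
      assume k: "k = 6"
      then have "l \<in> {6, 8, 10, 11}"
        using range[OF that(2)] that(3) no1 no2 no3 no4 by (elim insertE emptyE) auto
      then show ?thesis using up6 k by blast
    next
      assume k: "k = 7"
      then have "l \<in> {7, 8, 9, 10, 11}"
        using range[OF that(2)] that(3) no1 no2 no3 no5 by (elim insertE emptyE) auto
      then show ?thesis using up7 k by blast
    next
      assume k: "k = 8"
      then have "l \<in> {8, 10, 11}"
        using range[OF that(2)] that(3) no1 no2 no3 no4 no5 by (elim insertE emptyE) auto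
      then show ?thesis using up8 k by blast
    next
      assume k: "k = 9"
      then have "l \<in> {9, 10, 11}"
        using range[OF that(2)] that(3) no1 no2 no3 no5 no6 by (elim insertE emptyE) auto
      then show ?thesis using up9 k by blast
    next
      assume k: "k = 10"
      then have "l \<in> {10, 11}"
        using range[OF that(2)] that(3) no1 no2 no3 no4 no5 no6 by (elim insertE emptyE) auto
      then show ?thesis using up10 k by blast
    next
      assume k: "k = 11"
      then have "l \<in> {11}"
        using range[OF that(2)] that(3) no1 no2 no3 no4 no5 no6 no7 by (elim insertE emptyE) auto
      then show ?thesis using up11 k by blast
    qed
  qed
  \<comment> \<open>Properness: each reversed basic pair lies in one of the rectangles.\<close>
  moreover have "\<not> R l \<subseteq> R k" if "(k, l) \<in> basic_pairs" for k l
    using that no1 no2 no3 no4 no5 no6 no7 unfolding basic_pairs_def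
    by (elim insertE emptyE) auto
  ultimately show ?thesis unfolding hierarchy_def using mono basic by blast
qed

section \<open>A rigid digraph on every infinite set\<close>

text \<open>All self-embeddings but the identity are excluded, not only automorphisms. This makes
  every copy of a coded structure contain the whole rigid part.\<close>

definition rigid_on :: "'v set \<Rightarrow> 'v rel \<Rightarrow> bool" where
  "rigid_on V R \<longleftrightarrow> (\<forall>G. inj_on G V \<longrightarrow> G ` V \<subseteq> V \<longrightarrow>
     (\<forall>x\<in>V. \<forall>y\<in>V. (x, y) \<in> R \<longleftrightarrow> (G x, G y) \<in> R) \<longrightarrow> (\<forall>x\<in>V. G x = x))"

text \<open>An arbitrary well-order of A is changed by moving T to the end. A last element bounds
  every infinite increasing sequence strictly, so such a sequence has a supremum in A, as
  \<open>rigid_embedding\<close> requires.\<close>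

lemma ex_well_order_with_top:
  assumes "T \<in> A"
  obtains lt where "wf lt" "trans lt" "total_on A lt" "lt \<subseteq> A \<times> A"
    "\<And>a. a \<in> A \<Longrightarrow> a = T \<or> (a, T) \<in> lt"
proof -
  obtain r where r: "well_order_on A r" using well_order_on by blast
  then have wf: "wf (r - Id)" and lin: "linear_order_on A r" unfolding well_order_on_def by auto
  define lt where "lt = {(x, y) \<in> A \<times> A. x \<noteq> T \<and> (y = T \<or> (x, y) \<in> r - Id)}"
  have "lt \<subseteq> inv_image (less_than <*lex*> (r - Id)) (\<lambda>x. (if x = T then 1 else 0, x))"
    unfolding lt_def by auto
  then have "wf lt" using wf by (meson wf_inv_image wf_less_than wf_lex_prod wf_subset)
  moreover have "trans (r - Id)"
    using lin by (simp add: linear_order_on_def partial_order_on_def preorder_on_def trans_diff_Id)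
  then have "trans lt" unfolding lt_def trans_def by blast
  moreover have "total_on A lt"
    using lin unfolding lt_def linear_order_on_def total_on_def by blast
  moreover have "a = T \<or> (a, T) \<in> lt" if "a \<in> A" for a
    using that assms unfolding lt_def by blast
  ultimately show ?thesis using that unfolding lt_def by blast
qed

locale top_well_order =
  fixes A :: "'a set" and lt :: "'a rel" and T :: 'a
  assumes wf: "wf lt" and trans: "trans lt" and total: "total_on A lt" and sub: "lt \<subseteq> A \<times> A"
    and T: "T \<in> A" and top: "a \<in> A \<Longrightarrow> a = T \<or> (a, T) \<in> lt"
begin

lemma irrefl: "(a, a) \<notin> lt"
  using wf by simp

lemma asym: "(a, b) \<in> lt \<Longrightarrow> (b, a) \<notin> lt"
  using wf wf_not_sym by metis

text \<open>Monotonicity is not demanded, so a constant sequence serves at a successor. For \<alpha>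
  in A such a sequence exists exactly when \<alpha> is a successor or a limit of cofinality
  omega.\<close>

definition cofinal_seq :: "'a \<Rightarrow> (nat \<Rightarrow> 'a) \<Rightarrow> bool" where
  "cofinal_seq \<alpha> s \<longleftrightarrow> (\<forall>n. (s n, \<alpha>) \<in> lt) \<and> (\<forall>b. (b, \<alpha>) \<in> lt \<longrightarrow> (\<exists>n. b = s n \<or> (b, s n) \<in> lt))"

text \<open>The second component records the position in the cofinal sequence, so that a map
  preserving it sends the n-th rung to the n-th rung. Where there is no such sequence all rungs lie
  at level 0, so a rung at level 1 tells the two kinds apart.\<close>

definition ladder :: "'a \<Rightarrow> ('a \<times> nat) set" where
  "ladder \<alpha> =
    (if \<exists>s. cofinal_seq \<alpha> s then {((SOME s. cofinal_seq \<alpha> s) n, n) | n. True}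
     else {(b, 0) | b. (b, \<alpha>) \<in> lt})"

text \<open>
  A variant of the rigid relations of Vopenka, Pultr and Hedrlin. Loops and paths force an embedding
  to be of the form \<open>(a, n) \<mapsto> (g a, n)\<close>, and the ladders make \<open>g\<close> increasing.
\<close>

definition rigid :: "('a \<times> nat) rel" where
  "rigid = {((a, n), (a, Suc n)) | a n. a \<in> A} \<union> {((a, 0), (a, 0)) | a. a \<in> A} \<union>
     {(x, (\<alpha>, 0)) | x \<alpha>. x \<in> ladder \<alpha>}"

lemma ladder_cases:
  obtains s where "cofinal_seq \<alpha> s" "ladder \<alpha> = {(s n, n) | n. True}"
  | "\<nexists>s. cofinal_seq \<alpha> s" "ladder \<alpha> = {(b, 0) | b. (b, \<alpha>) \<in> lt}"
proof (cases "\<exists>s. cofinal_seq \<alpha> s")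
  case True
  then show ?thesis using that(1)[of "SOME s. cofinal_seq \<alpha> s"] someI_ex[OF True]
    unfolding ladder_def by auto
next
  case False
  then show ?thesis by (intro that(2)) (auto simp: ladder_def)
qed

text \<open>Either alternative excludes the second kind of ladder. The sequence obtained is the one
  chosen for the ladder and may differ from \<open>l\<close>.\<close>

lemma cofinal_ladderE:
  assumes "cofinal_seq \<alpha> l \<or> (b, Suc m) \<in> ladder \<alpha>"
  obtains s where "cofinal_seq \<alpha> s" "ladder \<alpha> = {(s n, n) | n. True}"
proof (cases \<alpha> rule: ladder_cases)
  case (1 s)
  then show ?thesis by (rule that)
next
  case 2
  then show ?thesis using assms by auto
qed

lemma ladder_less: "(b, n) \<in> ladder \<alpha> \<Longrightarrow> (b, \<alpha>) \<in> lt"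
  by (cases \<alpha> rule: ladder_cases) (auto simp: cofinal_seq_def)

lemma rigid_loop_iff: "a \<in> A \<Longrightarrow> ((a, n), (a, n)) \<in> rigid \<longleftrightarrow> n = 0"
  unfolding rigid_def using ladder_less irrefl by auto

lemma rigid_Suc_iff: "((a, n), (b, Suc m)) \<in> rigid \<longleftrightarrow> a \<in> A \<and> a = b \<and> m = n"
  unfolding rigid_def by auto

lemma rigid_0_iff: "a \<noteq> b \<Longrightarrow> ((a, n), (b, 0)) \<in> rigid \<longleftrightarrow> (a, n) \<in> ladder b"
  unfolding rigid_def by auto

lemma rigid_antisym: "(x, y) \<in> rigid \<Longrightarrow> (y, x) \<in> rigid \<Longrightarrow> x = y"
  unfolding rigid_def using ladder_less irrefl asym by fastforce

text \<open>A strictly increasing \<open>g\<close> on a well-order moves no element down. If it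
  moves \<open>a\<close> up, the supremum \<open>d\<close> of the iterates of \<open>a\<close> has a
  cofinal sequence; comparing rungs shows that \<open>g\<close> fixes \<open>d\<close> and then
  every rung of \<open>d\<close>, but a fixed rung above \<open>a\<close> bounds all iterates
  strictly below \<open>d\<close>.\<close>

lemma rigid_embedding:
  assumes inj: "inj_on G (A \<times> UNIV)" and maps: "G ` (A \<times> UNIV) \<subseteq> A \<times> UNIV"
    and emb: "\<And>x y. x \<in> A \<times> UNIV \<Longrightarrow> y \<in> A \<times> UNIV \<Longrightarrow> (x, y) \<in> rigid \<longleftrightarrow> (G x, G y) \<in> rigid"
    and x: "x \<in> A \<times> UNIV"
  shows "G x = x"
proof -
  define g where "g a = fst (G (a, 0))" for a
  have GA: "fst (G (a, n)) \<in> A" if "a \<in> A" for a n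
  proof -
    have "G (a, n) \<in> A \<times> UNIV" using maps that by (meson SigmaI UNIV_I imageI subsetD)
    then show ?thesis by (simp add: mem_Times_iff)
  qed
  have loop: "(snd (G (a, n)) = 0) \<longleftrightarrow> n = 0" if a: "a \<in> A" for a n
    using emb[of "(a, n)" "(a, n)"] rigid_loop_iff[OF a, of n]
      rigid_loop_iff[OF GA[OF a], of n "snd (G (a, n))"] a by simp
  have gA: "g a \<in> A" if "a \<in> A" for a
    unfolding g_def using GA that .
  have G: "G (a, n) = (g a, n)" if a: "a \<in> A" for a n
  proof (induction n)
    case 0
    then show ?case using loop[OF a, of 0] by (simp add: g_def prod_eq_iff)
  next
    case (Suc n)
    \<comment> \<open>Only level 0 has loops, so the image is at a positive level; the single edge
      into such a vertex comes from one level lower over the same element.\<close>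
    obtain b m where bm: "G (a, Suc n) = (b, m)" by fastforce
    then obtain m' where "m = Suc m'" using loop[OF a, of "Suc n"] by (cases m) auto
    moreover have "(G (a, n), G (a, Suc n)) \<in> rigid"
      using emb[of "(a, n)" "(a, Suc n)"] a rigid_Suc_iff by simp
    ultimately show ?case using Suc bm rigid_Suc_iff by auto
  qed
  have g_inj: "a = b" if "g a = g b" "a \<in> A" "b \<in> A" for a b
    using inj_onD[OF inj, of "(a, 0)" "(b, 0)"] G that by simp
  have ladder: "(g b, n) \<in> ladder (g \<alpha>)" if b: "(b, n) \<in> ladder \<alpha>" for b n \<alpha>
  proof -
    have "(b, \<alpha>) \<in> lt" using b by (rule ladder_less)
    then have *: "b \<in> A" "\<alpha> \<in> A" "b \<noteq> \<alpha>" using sub irrefl by auto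
    then have "((g b, n), (g \<alpha>, 0)) \<in> rigid"
      using b emb[of "(b, n)" "(\<alpha>, 0)"] G rigid_0_iff by simp
    moreover have "g b \<noteq> g \<alpha>" using * g_inj by blast
    ultimately show ?thesis using rigid_0_iff by simp
  qed
  have mono: "(b, \<alpha>) \<in> lt \<Longrightarrow> (g b, g \<alpha>) \<in> lt" for b \<alpha>
  proof (induction \<alpha> arbitrary: b rule: wf_induct_rule[OF wf])
    case (1 \<alpha>)
    show ?case
    proof (cases \<alpha> rule: ladder_cases)
      case (1 s)
      \<comment> \<open>The embedding controls rungs only; any other element below \<alpha> lies
        under a rung, where the induction hypothesis applies.\<close>
      then obtain n where n: "b = s n \<or> (b, s n) \<in> lt" "(s n, \<alpha>) \<in> lt"
        using \<open>(b, \<alpha>) \<in> lt\<close> unfolding cofinal_seq_def by blast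
      have "(g (s n), g \<alpha>) \<in> lt" using ladder ladder_less 1(2) by blast
      moreover have "b = s n \<or> (g b, g (s n)) \<in> lt" using n "1.IH" by blast
      ultimately show ?thesis using trans by (metis transD)
    next
      case 2
      then have "(b, 0) \<in> ladder \<alpha>" using \<open>(b, \<alpha>) \<in> lt\<close> by simp
      then show ?thesis by (rule ladder_less[OF ladder])
    qed
  qed
  have ge: "(g a, a) \<notin> lt" if "a \<in> A" for a
    using that
  proof (induction a rule: wf_induct_rule[OF wf])
    case (1 a)
    show ?case
    proof
      assume *: "(g a, a) \<in> lt"
      then show False using "1.IH"[OF *] gA[OF \<open>a \<in> A\<close>] mono[OF *] by blast
    qed
  qed
  have linear: "a = b \<or> (a, b) \<in> lt \<or> (b, a) \<in> lt" if "a \<in> A" "b \<in> A" for a b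
    using total that unfolding total_on_def by blast
  have "g a = a" if a: "a \<in> A" for a
  proof (rule ccontr)
    assume "g a \<noteq> a"
    then have lt0: "(a, g a) \<in> lt" using ge[OF a] linear[OF gA[OF a] a] by auto
    define l where "l k = (g ^^ k) a" for k
    have l: "l 0 = a" "l (Suc k) = g (l k)" for k unfolding l_def by auto
    have lA: "l k \<in> A" for k by (induction k) (auto simp: l a gA)
    have l_less: "(l k, l (Suc k)) \<in> lt" for k
      by (induction k) (use l lt0 mono in auto)
    \<comment> \<open>No iterate is the last element, since the next one is larger; so strict upper
      bounds exist and \<open>d\<close> can be chosen least.\<close>
    have "(l k, T) \<in> lt" for k
      using top[OF lA, of k] top[OF lA, of "Suc k"] l_less[of k] irrefl asym by metis
    then have "T \<in> {d. \<forall>k. (l k, d) \<in> lt}" by simp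
    from wfE_min[OF wf this] obtain d where d: "\<And>k. (l k, d) \<in> lt"
      and least: "\<And>c. (c, d) \<in> lt \<Longrightarrow> \<exists>k. (l k, c) \<notin> lt"
      by auto
    have dA: "d \<in> A" using d sub by blast
    have cof: "\<exists>k. c = l k \<or> (c, l k) \<in> lt" if "(c, d) \<in> lt" for c
      using least[OF that] linear[of c] lA that sub by blast
    then have "cofinal_seq d l" unfolding cofinal_seq_def using d by blast
    from disjI1[OF this] obtain s
      where s: "cofinal_seq d s" "ladder d = {(s n, n) | n. True}"
      by (rule cofinal_ladderE)
    have below: "(g c, d) \<in> lt" if c: "(c, d) \<in> lt" for c
    proof -
      obtain k where "c = l k \<or> (c, l k) \<in> lt" using cof[OF c] by blast
      then have "g c = l (Suc k) \<or> (g c, l (Suc k)) \<in> lt" using mono l by auto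
      then show ?thesis using d trans by (metis transD)
    qed
    \<comment> \<open>The rung at level 1 shows that \<open>g d\<close> has a cofinal sequence as
      well, formed by the images of the rungs of \<open>d\<close>.\<close>
    have gs: "(g (s n), n) \<in> ladder (g d)" for n using ladder s(2) by blast
    from disjI2[OF gs[of "Suc 0"]] obtain s'
      where s': "cofinal_seq (g d) s'" "ladder (g d) = {(s' n, n) | n. True}"
      by (rule cofinal_ladderE)
    have s'_eq: "s' n = g (s n)" for n using gs s'(2) by simp
    have "(s n, d) \<in> lt" for n using s(1) unfolding cofinal_seq_def by blast
    then have s'd: "(s' n, d) \<in> lt" for n using s'_eq below by simp
    \<comment> \<open>The images of the rungs stay below \<open>d\<close>, so they could not be
      cofinal in a larger \<open>g d\<close>.\<close>
    have "(d, g d) \<notin> lt"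
      using s'(1) s'd irrefl asym unfolding cofinal_seq_def by metis
    then have gd: "g d = d" using ge[OF dA] linear[OF gA[OF dA] dA] by auto
    then have gs_eq: "g (s n) = s n" for n using gs s(2) by simp
    obtain n where n: "a = s n \<or> (a, s n) \<in> lt"
      using s(1) d[of 0] unfolding cofinal_seq_def l by blast
    have "l k = s n \<or> (l k, s n) \<in> lt" for k
    proof (induction k)
      case (Suc k)
      then show ?case using mono[of "l k" "s n"] gs_eq[of n] l by auto
    qed (use n l in simp)
    then have "(l k, s n) \<in> lt" for k using l_less transD[OF trans] by metis
    then show False using least[OF \<open>\<And>n. (s n, d) \<in> lt\<close>] by blast
  qed
  then show ?thesis using G x by (cases x) auto
qed

end

lemma ex_rigid:
  fixes A :: "'a set"
  assumes "A \<noteq> {}"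
  obtains R :: "('a \<times> nat) rel" where
    "\<forall>a\<in>A. ((a, 0), (a, 0)) \<in> R" "antisym R" "rigid_on (A \<times> UNIV) R"
proof -
  obtain T where T: "T \<in> A" using assms by blast
  then obtain lt where "wf lt" "trans lt" "total_on A lt" "lt \<subseteq> A \<times> A"
    "\<And>a. a \<in> A \<Longrightarrow> a = T \<or> (a, T) \<in> lt" using ex_well_order_with_top by metis
  then interpret top_well_order A lt T using T by unfold_locales
  show ?thesis
  proof (rule that[of rigid])
    show "\<forall>a\<in>A. ((a, 0), (a, 0)) \<in> rigid" using rigid_loop_iff by simp
    show "antisym rigid" by (rule antisymI) (rule rigid_antisym)
    show "rigid_on (A \<times> UNIV) rigid"
      unfolding rigid_on_def by (intro allI impI ballI) (rule rigid_embedding, auto)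
  qed
qed

section \<open>Digraphs on a whole type and their copies\<close>

definition digraph_embedding :: "'z rel \<Rightarrow> 'z rel \<Rightarrow> ('z \<Rightarrow> 'z) \<Rightarrow> bool" where
  "digraph_embedding D E e \<longleftrightarrow> inj e \<and> (\<forall>x y. (x, y) \<in> D \<longleftrightarrow> (e x, e y) \<in> E)"

definition digraph_copies :: "'z rel \<Rightarrow> 'z set set" where
  "digraph_copies D = {range e | e. digraph_embedding D D e}"

definition digraph_order :: "'z rel \<Rightarrow> 'z set rel" where
  "digraph_order D = relation_of (\<subseteq>) (digraph_copies D)"

lemma digraph_order_iff:
  "(C, C') \<in> digraph_order D \<longleftrightarrow> C \<in> digraph_copies D \<and> C' \<in> digraph_copies D \<and> C \<subseteq> C'"
  unfolding digraph_order_def relation_of_def by simp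

lemma Field_digraph_order [simp]: "Field (digraph_order D) = digraph_copies D"
  unfolding Field_def by (auto simp: digraph_order_iff)

lemma preord_digraph_order: "preord (digraph_order D)"
  by standard (auto simp: digraph_order_iff)

section \<open>Coding countable digraphs\<close>

lemma ex_coding_bij:
  includes cardinal_syntax
  assumes "infinite X"
  obtains h :: "'a \<Rightarrow> 'z::countable + ('a \<times> nat)" where "bij_betw h X (UNIV <+> X \<times> UNIV)"
proof -
  have nat: "|UNIV :: nat set| \<le>o |X|" using assms infinite_iff_card_of_nat by blast
  then have times: "|X \<times> (UNIV :: nat set)| =o |X|" using assms card_of_Times_infinite by blast
  have "|UNIV :: 'z set| \<le>o |UNIV :: nat set|"
    using card_of_ordLeq[of "UNIV :: 'z set" "UNIV :: nat set"] inj_to_nat by blast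
  then have "|UNIV :: 'z set| \<le>o |X \<times> (UNIV :: nat set)|"
    using nat times ordIso_symmetric ordLeq_ordIso_trans ordLeq_transitive by metis
  moreover have "infinite (X \<times> (UNIV :: nat set))" using assms by (auto simp: finite_cartesian_product_iff)
  ultimately have "|(UNIV :: 'z set) <+> X \<times> (UNIV :: nat set)| =o |X \<times> (UNIV :: nat set)|"
    using card_of_Plus_infinite by blast
  then have "|X| =o |(UNIV :: 'z set) <+> X \<times> (UNIV :: nat set)|"
    using times ordIso_symmetric ordIso_transitive by metis
  then show ?thesis using that card_of_ordIso by blast
qed

text \<open>
  The set \<open>X\<close> is identified with the disjoint union of the vertex set of a countable digraph and
  a rigid digraph. The double edges between the parts, and the absence of double edges and loops in
  the countable part, let an embedding respect the parts.
\<close>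

locale coding =
  fixes L :: "'i lang" and i0 :: 'i and n :: nat and X :: "'a set"
    and h :: "'a \<Rightarrow> 'z + ('a \<times> nat)" and R :: "('a \<times> nat) rel"
  assumes L: "L i0 = Some n" and n: "n \<ge> 2" and nonempty: "X \<noteq> {}"
    and h: "bij_betw h X (UNIV <+> X \<times> UNIV)"
    and R_loop: "\<forall>a\<in>X. ((a, 0), (a, 0)) \<in> R" and R_antisym: "antisym R"
    and R_rigid: "rigid_on (X \<times> UNIV) R"
begin

fun edge :: "'z rel \<Rightarrow> 'z + ('a \<times> nat) \<Rightarrow> 'z + ('a \<times> nat) \<Rightarrow> bool" where
  "edge D (Inl x) (Inl y) \<longleftrightarrow> (x, y) \<in> D"
| "edge D (Inr p) (Inr q) \<longleftrightarrow> (p, q) \<in> R"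
| "edge D (Inl x) (Inr q) \<longleftrightarrow> True"
| "edge D (Inr p) (Inl y) \<longleftrightarrow> True"

text \<open>Reading only the first two coordinates allows any arity from 2 on; the other relations
  of the language are empty and constrain no embedding.\<close>

definition code :: "'z rel \<Rightarrow> 'i \<Rightarrow> 'a list set" where
  "code D i = (if i = i0 then {xs \<in> tuples X n. edge D (h (xs ! 0)) (h (xs ! 1))}
     else if i \<in> dom L then {} else undefined)"

abbreviation struct :: "'z rel \<Rightarrow> ('i, 'a) struct" where
  "struct D \<equiv> (X, code D)"

abbreviation decode :: "'z + ('a \<times> nat) \<Rightarrow> 'a" where
  "decode \<equiv> inv_into X h"

definition lift :: "('z \<Rightarrow> 'z) \<Rightarrow> 'a \<Rightarrow> 'a" where
  "lift e x = decode (map_sum e id (h x))"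

text \<open>Depends on \<open>C\<close> alone and not on the digraph, which turns equality of the
  copies of two coded structures into equality of digraph copies.\<close>

definition extend :: "'z set \<Rightarrow> 'a set" where
  "extend C = {x \<in> X. h x \<in> Inl ` C \<union> range Inr}"

lemma code_Interp: "code D \<in> Interp L X"
  unfolding Interp_def code_def using L by (auto simp: PiE_iff extensional_def)

lemma h_decode [simp]: "w \<in> UNIV <+> X \<times> UNIV \<Longrightarrow> h (decode w) = w"
  by (rule bij_betw_inv_into_right[OF h])

lemma decode_h [simp]: "x \<in> X \<Longrightarrow> decode (h x) = x"
  by (rule bij_betw_inv_into_left[OF h])

lemma decode_in [simp]: "w \<in> UNIV <+> X \<times> UNIV \<Longrightarrow> decode w \<in> X"
  using bij_betw_inv_into[OF h] by (rule bij_betw_apply)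

lemma h_in [simp]: "x \<in> X \<Longrightarrow> h x \<in> UNIV <+> X \<times> UNIV"
  using h by (rule bij_betw_apply)

lemma decode_Inl [simp]: "decode (Inl z) \<in> X" "h (decode (Inl z)) = Inl z"
  by (intro decode_in h_decode; blast)+

lemma embedding_struct_iff:
  "embedding L (struct D) (struct E) f \<longleftrightarrow> inj_on f X \<and> f ` X \<subseteq> X \<and>
     (\<forall>x\<in>X. \<forall>y\<in>X. edge D (h x) (h y) \<longleftrightarrow> edge E (h (f x)) (h (f y)))"
proof -
  have "(\<forall>i\<in>dom L. \<forall>xs\<in>tuples X (the (L i)). xs \<in> code D i \<longleftrightarrow> map f xs \<in> code E i) \<longleftrightarrow>
      (\<forall>x\<in>X. \<forall>y\<in>X. edge D (h x) (h y) \<longleftrightarrow> edge E (h (f x)) (h (f y)))" (is "?l \<longleftrightarrow> ?r")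
    if f: "f ` X \<subseteq> X"
  proof
    assume l: ?l
    show ?r
    proof (intro ballI)
      fix x y assume xy: "x \<in> X" "y \<in> X"
      \<comment> \<open>Padding with \<open>y\<close> gives a tuple of the right length;
        \<open>n \<ge> 2\<close> puts \<open>y\<close> at position 1.\<close>
      define xs where "xs = x # replicate (n - 1) y"
      have xs: "xs \<in> tuples X n" "xs ! 0 = x" "xs ! 1 = y"
        using n xy unfolding xs_def tuples_def by auto
      moreover have "xs \<in> code D i0 \<longleftrightarrow> map f xs \<in> code E i0"
        using l L xs by (auto simp: domI)
      moreover have "0 < length xs" "1 < length xs" using n by (simp_all add: xs_def)
      ultimately show "edge D (h x) (h y) \<longleftrightarrow> edge E (h (f x)) (h (f y))"
        using map_tuples[OF f xs(1)] unfolding code_def by (simp del: One_nat_def)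
    qed
  next
    assume r: ?r
    show ?l
    proof (intro ballI)
      fix i xs assume i: "i \<in> dom L" and xs: "xs \<in> tuples X (the (L i))"
      show "xs \<in> code D i \<longleftrightarrow> map f xs \<in> code E i"
      proof (cases "i = i0")
        case True
        then have xs: "xs \<in> tuples X n" using xs L by simp
        then have len: "0 < length xs" "1 < length xs" using n unfolding tuples_def by auto
        moreover from this have "xs ! 0 \<in> X" "xs ! 1 \<in> X"
          using xs nth_mem unfolding tuples_def by blast+
        ultimately show ?thesis
          using True xs map_tuples[OF f xs] r unfolding code_def by (simp del: One_nat_def)
      qed (use i in \<open>simp add: code_def\<close>)
    qed
  qed
  then show ?thesis unfolding embedding_def by auto
qed

lemma lift_embedding:
  assumes "digraph_embedding D E e"
  shows "embedding L (struct D) (struct E) (lift e)"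
proof -
  have in_W: "map_sum e id w \<in> UNIV <+> X \<times> UNIV" if "w \<in> UNIV <+> X \<times> UNIV" for w
    using that by (cases w) auto
  have h_lift: "h (lift e x) = map_sum e id (h x)" if "x \<in> X" for x
    unfolding lift_def using in_W[OF h_in[OF that]] by (rule h_decode)
  have inj: "inj (map_sum e (id :: 'a \<times> nat \<Rightarrow> _))"
    using assms unfolding digraph_embedding_def by (simp add: sum.inj_map)
  have "inj_on (lift e) X"
  proof (rule inj_onI)
    fix x y assume "x \<in> X" "y \<in> X" "lift e x = lift e y"
    then have "h x = h y" using h_lift inj by (metis injD)
    then show "x = y" using \<open>x \<in> X\<close> \<open>y \<in> X\<close> decode_h by metis
  qed
  moreover have "lift e ` X \<subseteq> X"
    unfolding lift_def using in_W h_in decode_in by blast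
  moreover have "edge D u v \<longleftrightarrow> edge E (map_sum e id u) (map_sum e id v)" for u v
    using assms unfolding digraph_embedding_def by (cases u; cases v) auto
  then have "edge D (h x) (h y) \<longleftrightarrow> edge E (h (lift e x)) (h (lift e y))" if "x \<in> X" "y \<in> X" for x y
    using h_lift that by simp
  ultimately show ?thesis unfolding embedding_struct_iff by blast
qed

lemma embedding_is_lift:
  assumes D: "asym D" and E: "asym E" and f: "embedding L (struct D) (struct E) f"
  obtains e where "digraph_embedding D E e" "\<And>x. x \<in> X \<Longrightarrow> f x = lift e x"
proof -
  define F where "F w = h (f (decode w))" for w
  let ?W = "UNIV <+> X \<times> UNIV :: ('z + ('a \<times> nat)) set"
  have fX: "inj_on f X" "f ` X \<subseteq> X" using f embedding_struct_iff by auto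
  have F_in: "F w \<in> ?W" if "w \<in> ?W" for w
    unfolding F_def using fX(2) decode_in[OF that] by (intro h_in) blast
  have F_inj: "u = v" if "F u = F v" "u \<in> ?W" "v \<in> ?W" for u v
  proof -
    have "f (decode u) = f (decode v)"
      using that fX(2) decode_in decode_h unfolding F_def by (metis image_subset_iff)
    then have "decode u = decode v" using fX(1) that decode_in by (meson inj_onD)
    then show ?thesis using that h_decode by metis
  qed
  have F_edge: "edge D u v \<longleftrightarrow> edge E (F u) (F v)" if "u \<in> ?W" "v \<in> ?W" for u v
    using f that decode_in h_decode unfolding embedding_struct_iff F_def by metis
  have no_loop: "(z, z) \<notin> E" and no_double: "(z, z') \<in> E \<Longrightarrow> (z', z) \<notin> E" for z z'
    using E by (auto dest: asymD)
  obtain a where a: "a \<in> X" using nonempty by blast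
  have aW: "Inr (a, 0) \<in> ?W" using a by auto
  have Inr_in: "Inr p \<in> ?W \<longleftrightarrow> p \<in> X \<times> UNIV" and Inl_in: "Inl z \<in> ?W" for p z by auto
  \<comment> \<open>The loop at \<open>(a, 0)\<close> has no possible image in the loopless
    \<open>E\<close>.\<close>
  obtain p where p: "F (Inr (a, 0)) = Inr p"
    using F_edge[OF aW aW] R_loop a no_loop by (cases "F (Inr (a, 0))") auto
  \<comment> \<open>\<open>Inl z\<close> is joined to \<open>Inr (a, 0)\<close> in both directions.
    A double edge inside the antisymmetric \<open>R\<close> is a loop, so both vertices would have
    the same image.\<close>
  have "\<exists>z'. F (Inl z) = Inl z'" for z
  proof (cases "F (Inl z)")
    case (Inr q)
    have "(q, p) \<in> R" "(p, q) \<in> R"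
      using F_edge[OF Inl_in aW, of z] F_edge[OF aW Inl_in, of z] Inr p by auto
    then have "F (Inl z) = F (Inr (a, 0))" using antisymD[OF R_antisym] Inr p by simp
    then show ?thesis using F_inj[OF _ Inl_in aW] by blast
  qed auto
  then obtain e where e: "\<And>z. F (Inl z) = Inl (e z)" by metis
  \<comment> \<open>Here the double edge goes to a digraph vertex, for which
    \<open>undefined\<close> is an arbitrary choice; it cannot be mapped into the asymmetric
    \<open>E\<close>.\<close>
  have "\<exists>q. F (Inr y) = Inr q" if y: "y \<in> X \<times> UNIV" for y
  proof (cases "F (Inr y)")
    case (Inl z')
    have yW: "Inr y \<in> ?W" using y by auto
    then have "(z', e undefined) \<in> E" "(e undefined, z') \<in> E"
      using F_edge[OF yW Inl_in, of undefined] F_edge[OF Inl_in yW, of undefined] Inl e by auto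
    then show ?thesis using no_double by blast
  qed auto
  then obtain G where G: "\<And>y. y \<in> X \<times> UNIV \<Longrightarrow> F (Inr y) = Inr (G y)" by metis
  have "\<forall>y\<in>X \<times> UNIV. G y = y"
  proof (rule R_rigid[unfolded rigid_on_def, THEN spec, THEN mp, THEN mp, THEN mp])
    show "inj_on G (X \<times> UNIV)"
    proof (rule inj_onI)
      fix p q :: "'a \<times> nat" assume pq: "p \<in> X \<times> UNIV" "q \<in> X \<times> UNIV" "G p = G q"
      then have "F (Inr p) = F (Inr q)" using G by simp
      then show "p = q" using F_inj[of "Inr p" "Inr q"] pq Inr_in by simp
    qed
    show "G ` (X \<times> UNIV) \<subseteq> X \<times> UNIV"
    proof (rule image_subsetI)
      fix p :: "'a \<times> nat" assume p: "p \<in> X \<times> UNIV"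
      show "G p \<in> X \<times> UNIV" using F_in[of "Inr p"] G[OF p] p Inr_in by simp
    qed
    have "(p, q) \<in> R \<longleftrightarrow> (G p, G q) \<in> R" if "p \<in> X \<times> UNIV" "q \<in> X \<times> UNIV" for p q
      using F_edge[of "Inr p" "Inr q"] G[OF that(1)] G[OF that(2)] that Inr_in by simp
    then show "\<forall>p\<in>X \<times> UNIV. \<forall>q\<in>X \<times> UNIV. (p, q) \<in> R \<longleftrightarrow> (G p, G q) \<in> R" by blast
  qed
  then have F: "F w = map_sum e id w" if "w \<in> ?W" for w
    using e G that by (cases w) auto
  show ?thesis
  proof (rule that[of e])
    have "e x = e y \<Longrightarrow> x = y" for x y using F_inj[OF _ Inl_in Inl_in, of x y] e by auto
    moreover have "(x, y) \<in> D \<longleftrightarrow> (e x, e y) \<in> E" for x y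
      using F_edge[OF Inl_in Inl_in, of x y] e by auto
    ultimately show "digraph_embedding D E e" unfolding digraph_embedding_def inj_def by blast
    fix x assume x: "x \<in> X"
    then have "f x \<in> X" using fX by blast
    then have "f x = decode (F (h x))" using x unfolding F_def by simp
    then show "f x = lift e x" unfolding lift_def using F x by simp
  qed
qed

lemma lift_image: "lift e ` X = extend (range e)"
proof (intro equalityI subsetI)
  fix y assume "y \<in> lift e ` X"
  then obtain x where x: "x \<in> X" "y = decode (map_sum e id (h x))" unfolding lift_def by blast
  then have "map_sum e id (h x) \<in> UNIV <+> X \<times> UNIV" using h_in[OF x(1)] by (cases "h x") auto
  then have "y \<in> X" "h y = map_sum e id (h x)" using x by auto
  then show "y \<in> extend (range e)" unfolding extend_def by (cases "h x") auto
next
  fix y assume "y \<in> extend (range e)"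
  then have y: "y \<in> X" "h y \<in> Inl ` range e \<union> range Inr" unfolding extend_def by auto
  have "\<exists>w. h y = map_sum e id w \<and> w \<in> UNIV <+> X \<times> UNIV"
  proof (cases "h y")
    case (Inl z)
    then obtain z' where "z = e z'" using y(2) by auto
    then show ?thesis using Inl by (intro exI[of _ "Inl z'"]) auto
  next
    case (Inr p)
    then show ?thesis using h_in[OF y(1)] by (intro exI[of _ "Inr p"]) auto
  qed
  then obtain w where w: "h y = map_sum e id w" "w \<in> UNIV <+> X \<times> UNIV" by blast
  then have "y = lift e (decode w)" unfolding lift_def using decode_h[OF y(1)] by simp
  then show "y \<in> lift e ` X" using w by simp
qed

lemma extend_mono_iff: "extend C \<subseteq> extend C' \<longleftrightarrow> C \<subseteq> C'"
proof
  assume sub: "extend C \<subseteq> extend C'"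
  show "C \<subseteq> C'"
  proof
    fix z assume "z \<in> C"
    then have "decode (Inl z) \<in> extend C" unfolding extend_def by simp
    then have "decode (Inl z) \<in> extend C'" using sub by blast
    then show "z \<in> C'" unfolding extend_def by auto
  qed
qed (auto simp: extend_def)

lemma extend_UNIV: "extend UNIV = X"
proof -
  have "w \<in> range Inl \<union> range Inr" for w :: "'z + ('a \<times> nat)" by (cases w) auto
  then show ?thesis unfolding extend_def by blast
qed

lemma copies_struct:
  assumes "asym D"
  shows "copies L (struct D) = extend ` digraph_copies D"
proof (intro equalityI subsetI)
  fix C assume "C \<in> copies L (struct D)"
  then obtain f where f: "embedding L (struct D) (struct D) f" "C = f ` X" by (auto elim: copiesE)
  obtain e where e: "digraph_embedding D D e" "\<And>x. x \<in> X \<Longrightarrow> f x = lift e x"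
    using embedding_is_lift[OF assms assms f(1)] by blast
  then have "C = extend (range e)" using f(2) lift_image by (metis image_cong)
  then show "C \<in> extend ` digraph_copies D" using e(1) unfolding digraph_copies_def by blast
next
  fix C assume "C \<in> extend ` digraph_copies D"
  then obtain e where "digraph_embedding D D e" "C = lift e ` X"
    unfolding digraph_copies_def using lift_image by auto
  then show "C \<in> copies L (struct D)" using copiesI[OF lift_embedding] by simp
qed

lemma copies_struct_eq_iff:
  assumes "asym D" "asym E"
  shows "copies L (struct D) = copies L (struct E) \<longleftrightarrow> digraph_copies D = digraph_copies E"
proof -
  have "inj extend" using extend_mono_iff by (metis injI subset_antisym subset_refl)
  then show ?thesis using assms by (simp add: copies_struct inj_image_eq_iff)
qed

lemma copies_order_struct:
  assumes "asym D"
  shows "order_isomorphic (digraph_order D) (copies_order L (struct D))"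
  unfolding order_isomorphic_def
proof (intro exI conjI)
  have "inj extend" using extend_mono_iff by (metis injI subset_antisym subset_refl)
  then show "bij_betw extend (Field (digraph_order D)) (Field (copies_order L (struct D)))"
    using assms by (auto simp: copies_struct bij_betw_def intro: inj_on_subset)
qed (use assms in \<open>auto simp: copies_order_iff digraph_order_iff copies_struct extend_mono_iff\<close>)

lemma equimorphic_struct_iff:
  assumes "asym D" "asym E"
  shows "equimorphic L (struct D) (struct E) \<longleftrightarrow>
    (\<exists>e. digraph_embedding D E e) \<and> (\<exists>e. digraph_embedding E D e)"
  unfolding equimorphic_def
  using lift_embedding embedding_is_lift[OF assms] embedding_is_lift[OF assms(2,1)] by metis

lemma isomorphic_struct_iff:
  assumes "asym D" "asym E"
  shows "isomorphic L (struct D) (struct E) \<longleftrightarrow> (\<exists>e. digraph_embedding D E e \<and> surj e)"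
proof
  assume "isomorphic L (struct D) (struct E)"
  then obtain f where f: "embedding L (struct D) (struct E) f" "f ` X = X"
    unfolding isomorphic_def by auto
  obtain e where e: "digraph_embedding D E e" "\<And>x. x \<in> X \<Longrightarrow> f x = lift e x"
    using embedding_is_lift[OF assms f(1)] by blast
  then have "extend (range e) = X" using f(2) lift_image by (metis image_cong)
  then have "UNIV \<subseteq> range e" using extend_mono_iff[of UNIV "range e"] extend_UNIV by blast
  then have "surj e" by blast
  then show "\<exists>e. digraph_embedding D E e \<and> surj e" using e(1) by blast
next
  assume "\<exists>e. digraph_embedding D E e \<and> surj e"
  then obtain e where e: "digraph_embedding D E e" "surj e" by blast
  have "lift e ` X = X" unfolding lift_image e(2) by (rule extend_UNIV)
  then show "isomorphic L (struct D) (struct E)"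
    unfolding isomorphic_def using lift_embedding[OF e(1)] by auto
qed

text \<open>Equal codes would make the identity an embedding between the two structures, hence the
  edges of the digraph parts would agree.\<close>

lemma code_neq:
  assumes "D \<noteq> E"
  shows "code D \<noteq> code E"
proof
  assume eq: "code D = code E"
  have "embedding L (struct D) (struct D) id" by (rule embedding_id)
  then have "embedding L (struct D) (struct E) id" using eq by simp
  then have "\<forall>x\<in>X. \<forall>y\<in>X. edge D (h x) (h y) \<longleftrightarrow> edge E (h x) (h y)"
    unfolding embedding_struct_iff by simp
  then have "edge D (h (decode (Inl x))) (h (decode (Inl y))) \<longleftrightarrow>
      edge E (h (decode (Inl x))) (h (decode (Inl y)))" for x y
    using decode_Inl(1) by blast
  then have "(x, y) \<in> D \<longleftrightarrow> (x, y) \<in> E" for x y by simp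
  then show False using assms by auto
qed

end

section \<open>Examples of digraphs\<close>

lemma digraph_embeddingD:
  "digraph_embedding D E e \<Longrightarrow> (x, y) \<in> D \<Longrightarrow> (e x, e y) \<in> E"
  unfolding digraph_embedding_def by blast

lemma digraph_copiesI: "digraph_embedding D D e \<Longrightarrow> range e \<in> digraph_copies D"
  unfolding digraph_copies_def by blast

lemma digraph_embedding_converse:
  "digraph_embedding (D\<inverse>) (E\<inverse>) e \<longleftrightarrow> digraph_embedding D E e"
  unfolding digraph_embedding_def by auto

text \<open>Reversing all edges keeps the self-embeddings, so passing to the converse can change a
  digraph without changing its copies. This serves (1,0), (2,3) and (4,9).\<close>

lemma digraph_copies_converse: "digraph_copies (D\<inverse>) = digraph_copies D"
  unfolding digraph_copies_def digraph_embedding_converse ..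

lemma infinite_digraph_copies:
  assumes "infinite (UNIV :: 'z set)" "C \<in> digraph_copies (D :: 'z rel)"
  shows "infinite C"
  using assms unfolding digraph_copies_def digraph_embedding_def
  by (auto dest: finite_imageD)

section \<open>Directed posets and trivial separative quotients\<close>

definition directed :: "'p rel \<Rightarrow> bool" where
  "directed r \<longleftrightarrow> (\<forall>p\<in>Field r. \<forall>q\<in>Field r. \<exists>t. (t, p) \<in> r \<and> (t, q) \<in> r)"

text \<open>When any two conditions are compatible, \<open>le_star\<close> is the full relation on
  the carrier, so only one class remains.\<close>

lemma sq_directed:
  assumes "preord r" "directed r" "Field r \<noteq> {}"
  obtains A where "sq r = {(A, A)}"
proof -
  interpret preord r by fact
  have le: "le_star r = Field r \<times> Field r"
  proof (intro equalityI subrelI)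
    fix p q assume "(p, q) \<in> Field r \<times> Field r"
    then have F: "p \<in> Field r" "q \<in> Field r" by auto
    show "(p, q) \<in> le_star r"
    proof (rule le_starI[OF F])
      fix t assume "(t, p) \<in> r"
      then have "t \<in> Field r" by (rule FieldI1)
      then show "\<exists>s. (s, t) \<in> r \<and> (s, q) \<in> r"
        using assms(2) F(2) unfolding directed_def by blast
    qed
  qed (auto dest: le_star_Field)
  then have "eq_star r `` {p} = Field r" if "p \<in> Field r" for p
    using that unfolding eq_star_def by auto
  then have "sq r = {(Field r, Field r)}"
    using assms(3) unfolding sq_def le by auto
  then show ?thesis by (rule that)
qed

lemma sq_directed_iso:
  assumes "preord r" "directed r" "Field r \<noteq> {}" "preord s" "directed s" "Field s \<noteq> {}"
  shows "order_isomorphic (sq r) (sq s)"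
proof -
  obtain A where A: "sq r = {(A, A)}" using sq_directed[OF assms(1-3)] .
  obtain B where B: "sq s = {(B, B)}" using sq_directed[OF assms(4-6)] .
  show ?thesis unfolding order_isomorphic_iff A B by (intro exI[of _ "\<lambda>_. B"]) (simp add: Field_def)
qed

section \<open>Arrow, zigzag and stars\<close>

definition arrow :: "nat rel" where
  "arrow = {(0, 1)}"

lemma arrow: "asym arrow" "arrow \<noteq> arrow\<inverse>"
    "\<exists>e. digraph_embedding arrow (arrow\<inverse>) e \<and> surj e"
proof -
  let ?e = "\<lambda>n::nat. if n = 0 then 1 else if n = 1 then 0 else n"
  have "bij ?e" by (rule involuntory_imp_bij) simp
  then have "inj ?e" "surj ?e" by (auto simp: bij_def)
  moreover have "(x, y) \<in> arrow \<longleftrightarrow> (?e x, ?e y) \<in> arrow\<inverse>" for x y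
    unfolding arrow_def by auto
  ultimately show "\<exists>e. digraph_embedding arrow (arrow\<inverse>) e \<and> surj e"
    unfolding digraph_embedding_def by blast
qed (auto simp: arrow_def asym_on_def)

definition zigzag :: "nat rel" where
  "zigzag = {(m, n). even m \<and> (m = Suc n \<or> n = Suc m)}"

text \<open>The shift by one exchanges sources and sinks, hence the embeddings in both directions.
  An isomorphism onto the converse would send the end 0, the only vertex with a single neighbour, to
  an odd number, which has two.\<close>

lemma zigzag: "asym zigzag" "digraph_embedding zigzag (zigzag\<inverse>) Suc"
    "digraph_embedding (zigzag\<inverse>) zigzag Suc"
    "\<nexists>e. digraph_embedding zigzag (zigzag\<inverse>) e \<and> surj e"
proof -
  show "\<nexists>e. digraph_embedding zigzag (zigzag\<inverse>) e \<and> surj e"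
  proof clarify
    fix e :: "nat \<Rightarrow> nat" assume e: "digraph_embedding zigzag (zigzag\<inverse>) e" "surj e"
    then have inj: "inj e" and edge: "\<And>x y. (x, y) \<in> zigzag \<longleftrightarrow> (e y, e x) \<in> zigzag"
      unfolding digraph_embedding_def by auto
    have "(0, 1) \<in> zigzag" by (simp add: zigzag_def)
    then have "(e 1, e 0) \<in> zigzag" using edge by blast
    then obtain k where k: "e 0 = Suc k" "even k" unfolding zigzag_def by (cases "e 0") auto
    obtain a b where ab: "e a = k" "e b = Suc (Suc k)" using e(2) by (metis surjD)
    have "(0, a) \<in> zigzag" "(0, b) \<in> zigzag"
      using edge[of 0] k ab unfolding zigzag_def by auto
    then have "a = 1" "b = 1" unfolding zigzag_def by auto
    then show False using ab by simp
  qed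
qed (auto simp: zigzag_def asym_on_def digraph_embedding_def)

definition star :: "nat \<Rightarrow> nat rel" where
  "star c = {(c, n) | n. n \<noteq> c}"

lemma asym_star: "asym (star c)"
  unfolding star_def asym_on_def by auto

lemma star_iso: "\<exists>e. digraph_embedding (star 0) (star 1) e \<and> surj e"
proof -
  let ?e = "\<lambda>n::nat. if n = 0 then 1 else if n = 1 then 0 else n"
  have "bij ?e" by (rule involuntory_imp_bij) simp
  then have "inj ?e" "surj ?e" by (auto simp: bij_def)
  moreover have "(x, y) \<in> star 0 \<longleftrightarrow> (?e x, ?e y) \<in> star 1" for x y
    unfolding star_def by auto
  ultimately show ?thesis unfolding digraph_embedding_def by blast
qed

text \<open>Only the centre has outgoing edges, so self-embeddings fix it: copies of
  \<open>star 0\<close> contain 0, while a copy of \<open>star 1\<close> has to keep only 1.\<close>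

lemma star_copies: "digraph_copies (star 0) \<noteq> digraph_copies (star 1)"
proof -
  let ?e = "\<lambda>n::nat. if n = 1 then 1 else n + 2"
  have "inj ?e" by (auto simp: inj_def)
  then have "digraph_embedding (star 1) (star 1) ?e"
    unfolding digraph_embedding_def star_def by auto
  then have "range ?e \<in> digraph_copies (star 1)" by (rule digraph_copiesI)
  moreover have "0 \<notin> range ?e" by auto
  moreover have "0 \<in> C" if C: "C \<in> digraph_copies (star 0)" for C
  proof -
    obtain e where e: "digraph_embedding (star 0) (star 0) e" "C = range e"
      using C unfolding digraph_copies_def by blast
    have "(e 0, e 1) \<in> star 0" using digraph_embeddingD[OF e(1), of 0 1] by (simp add: star_def)
    then have "0 = e 0" by (simp add: star_def)
    then show ?thesis using e(2) by blast
  qed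
  ultimately show ?thesis by metis
qed

text \<open>Several edges leave 0, but no vertex of the converse has two outgoing edges.\<close>

lemma star_converse: "\<not> digraph_embedding (star 0) ((star 0)\<inverse>) e"
proof
  assume e: "digraph_embedding (star 0) ((star 0)\<inverse>) e"
  have "(0, 1) \<in> star 0" "(0, 2) \<in> star 0" by (auto simp: star_def)
  from this[THEN digraph_embeddingD[OF e]] have "e 1 = 0" "e 2 = 0" by (auto simp: star_def)
  then have "e 1 = e 2" by simp
  moreover have "inj e" using e by (simp add: digraph_embedding_def)
  ultimately show False by (simp add: inj_eq)
qed

section \<open>Rays with and without an isolated vertex\<close>

definition ray :: "nat rel" where
  "ray = {(n, Suc n) | n. True}"

definition ray_plus :: "nat rel" where
  "ray_plus = {(n, Suc n) | n. n > 0}"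

lemma asym_ray: "asym ray" "asym ray_plus"
  unfolding ray_def ray_plus_def asym_on_def by auto

lemma ray_equimorphic:
  "digraph_embedding ray ray_plus Suc"
  "digraph_embedding ray_plus ray (\<lambda>n. if n = 0 then 0 else Suc n)"
  unfolding digraph_embedding_def ray_def ray_plus_def inj_def by auto

lemma ray_copies:
  assumes "C \<in> digraph_copies ray"
  obtains k where "C = {k..}"
proof -
  obtain e where e: "digraph_embedding ray ray e" "C = range e"
    using assms unfolding digraph_copies_def by blast
  have "e n = e 0 + n" for n
  proof (induction n)
    case (Suc n)
    have "(e n, e (Suc n)) \<in> ray" using digraph_embeddingD[OF e(1)] by (simp add: ray_def)
    then show ?case using Suc by (simp add: ray_def)
  qed simp
  then have "range e = range ((+) (e 0))" by (metis (no_types))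
  also have "\<dots> = {e 0..}" by (auto simp: image_iff le_iff_add)
  finally show ?thesis using that e(2) by blast
qed

lemma UNIV_digraph_copies: "UNIV \<in> digraph_copies D"
  using digraph_copiesI[of D id] by (simp add: digraph_embedding_def)

lemma ray_total: "C \<in> digraph_copies ray \<Longrightarrow> C' \<in> digraph_copies ray \<Longrightarrow> C \<subseteq> C' \<or> C' \<subseteq> C"
  by (elim ray_copies) auto

lemma ray_directed: "directed (digraph_order ray)"
  unfolding directed_def Field_digraph_order digraph_order_iff
  using ray_total by (metis subset_refl)

text \<open>The gap between \<open>c\<close> and \<open>k\<close> keeps \<open>c\<close> isolated
  inside the copy.\<close>

lemma ray_plus_copy:
  assumes "Suc c < k"
  shows "insert c {k..} \<in> digraph_copies ray_plus"
proof -
  let ?e = "case_nat c ((+) k)"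
  have "inj ?e" using assms by (auto simp: inj_def split: nat.splits)
  moreover have "(x, y) \<in> ray_plus \<longleftrightarrow> (?e x, ?e y) \<in> ray_plus" for x y
    using assms unfolding ray_plus_def by (auto split: nat.splits)
  moreover have "range ?e = insert c {k..}"
  proof -
    have "x \<in> range ?e" if "x \<in> insert c {k..}" for x
    proof (cases "x = c")
      case True
      then show ?thesis using rangeI[of ?e 0] by simp
    next
      case False
      then have "x = ?e (Suc (x - k))" using that by simp
      then show ?thesis by (rule range_eqI)
    qed
    moreover have "?e n \<in> insert c {k..}" for n by (cases n) auto
    ultimately show ?thesis by blast
  qed
  ultimately show ?thesis using digraph_copiesI[of ray_plus ?e] by (simp add: digraph_embedding_def)
qed

text \<open>The vertices other than 0 form a ray, whose image is a final segment. Hence any two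
  copies share a final segment, which has room for a smaller copy.\<close>

lemma ray_plus_tail:
  assumes "C \<in> digraph_copies ray_plus"
  obtains k where "{k..} \<subseteq> C"
proof -
  obtain e where e: "digraph_embedding ray_plus ray_plus e" "C = range e"
    using assms unfolding digraph_copies_def by blast
  have "e (Suc n) = e 1 + n" for n
  proof (induction n)
    case (Suc n)
    have "(e (Suc n), e (Suc (Suc n))) \<in> ray_plus"
      using digraph_embeddingD[OF e(1)] by (simp add: ray_plus_def)
    then show ?case using Suc by (simp add: ray_plus_def)
  qed simp
  then have "e 1 + n \<in> C" for n using e(2) by (metis rangeI)
  then have "{e 1..} \<subseteq> C" by (metis atLeast_iff le_iff_add subsetI)
  then show ?thesis by (rule that)
qed

lemma ray_plus_directed: "directed (digraph_order ray_plus)"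
  unfolding directed_def
proof (intro ballI)
  fix C C' assume "C \<in> Field (digraph_order ray_plus)" "C' \<in> Field (digraph_order ray_plus)"
  then have CC: "C \<in> digraph_copies ray_plus" "C' \<in> digraph_copies ray_plus" by auto
  obtain k where k: "{k..} \<subseteq> C" using ray_plus_tail[OF CC(1)] .
  obtain k' where k': "{k'..} \<subseteq> C'" using ray_plus_tail[OF CC(2)] .
  let ?m = "max k k'"
  \<comment> \<open>Adding 2 leaves the gap that \<open>ray_plus_copy\<close> requires.\<close>
  have "insert ?m {?m + 2..} \<in> digraph_copies ray_plus" by (rule ray_plus_copy) simp
  moreover have "insert ?m {?m + 2..} \<subseteq> {k..}" "insert ?m {?m + 2..} \<subseteq> {k'..}" by auto
  ultimately show "\<exists>B. (B, C) \<in> digraph_order ray_plus \<and> (B, C') \<in> digraph_order ray_plus"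
    using k k' CC unfolding digraph_order_iff by (meson order_trans)
qed

lemma ray_not_order_isomorphic: "\<not> order_isomorphic (digraph_order ray) (digraph_order ray_plus)"
proof
  assume "order_isomorphic (digraph_order ray) (digraph_order ray_plus)"
  then obtain f where f: "bij_betw f (digraph_copies ray) (digraph_copies ray_plus)"
      "\<And>p q. p \<in> digraph_copies ray \<Longrightarrow> q \<in> digraph_copies ray \<Longrightarrow>
        (p, q) \<in> digraph_order ray \<longleftrightarrow> (f p, f q) \<in> digraph_order ray_plus"
    unfolding order_isomorphic_def by auto
  \<comment> \<open>Two incomparable copies, whereas the copies of the ray form a chain. Starting at
    3 keeps both 0 and 1 isolated.\<close>
  have "insert 0 {3..} \<in> digraph_copies ray_plus" "insert 1 {3..} \<in> digraph_copies ray_plus"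
    by (rule ray_plus_copy; simp)+
  then obtain p q where pq: "p \<in> digraph_copies ray" "q \<in> digraph_copies ray"
      "f p = insert 0 {3..}" "f q = insert 1 {3..}"
    using f(1) unfolding bij_betw_def by (metis imageE)
  then have "insert 0 {3..} \<subseteq> insert (1::nat) {3..} \<or> insert 1 {3..} \<subseteq> insert (0::nat) {3..}"
    using ray_total[OF pq(1,2)] f(2)[of p q] f(2)[of q p] by (auto simp: digraph_order_iff)
  then show False by auto
qed

section \<open>Binary trees\<close>

definition tree :: "bool list rel" where
  "tree = {(s, s @ [b]) | s b. True} \<union> {(s @ [False], s @ [True]) | s. True}"

text \<open>The three edges among the root and its children are removed from the tree, so
  \<open>[]\<close> becomes isolated and two copies of the tree remain.\<close>

definition forest :: "bool list rel" where
  "forest = {(s, s @ [b]) | s b. s \<noteq> []} \<union> {(s @ [False], s @ [True]) | s. s \<noteq> []}"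

definition cone :: "bool list \<Rightarrow> bool list set" where
  "cone v = range ((@) v)"

lemma asym_tree: "asym tree" "asym forest"
  unfolding tree_def forest_def asym_on_def by auto

lemma tree_append_iff: "(v @ s, v @ t) \<in> tree \<longleftrightarrow> (s, t) \<in> tree"
proof
  assume "(v @ s, v @ t) \<in> tree"
  then consider b where "v @ t = v @ s @ [b]"
    | u where "v @ s = u @ [False]" "v @ t = u @ [True]"
    unfolding tree_def by auto
  then show "(s, t) \<in> tree"
  proof cases
    case 1
    then show ?thesis unfolding tree_def by simp
  next
    case (2 u)
    have "s \<noteq> []" using 2 by auto
    then obtain s' b where s: "s = s' @ [b]" by (metis rev_exhaust)
    then have "u = v @ s'" "b = False" using 2(1) by (simp_all flip: append_assoc)
    then show ?thesis using s 2(2) unfolding tree_def by simp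
  qed
next
  assume "(s, t) \<in> tree"
  then show "(v @ s, v @ t) \<in> tree" unfolding tree_def by (auto simp flip: append_assoc)
qed

lemma tree_embedding: "digraph_embedding tree tree ((@) v)"
  unfolding digraph_embedding_def using tree_append_iff by (simp add: inj_def)

text \<open>The sibling edge makes a node with its two children the only kind of transitive
  triangle. Hence a self-embedding respects left and right children and is determined by the image
  of the root.\<close>

lemma tree_triangle:
  assumes "(v, x) \<in> tree" "(v, y) \<in> tree" "(x, y) \<in> tree"
  shows "x = v @ [False] \<and> y = v @ [True]"
  using assms unfolding tree_def by auto

lemma tree_copies: "C \<in> digraph_copies tree \<longleftrightarrow> (\<exists>v. C = cone v)"
proof
  assume "C \<in> digraph_copies tree"
  then obtain e where e: "digraph_embedding tree tree e" "C = range e"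
    unfolding digraph_copies_def by blast
  have step: "e (s @ [b]) = e s @ [b]" for s b
  proof -
    have "(s, s @ [False]) \<in> tree" "(s, s @ [True]) \<in> tree" "(s @ [False], s @ [True]) \<in> tree"
      unfolding tree_def by auto
    from tree_triangle[OF this[THEN digraph_embeddingD[OF e(1)]]] show ?thesis
      by (cases b) auto
  qed
  have "e s = e [] @ s" for s by (induction s rule: rev_induct) (simp_all add: step)
  then have "C = cone (e [])" unfolding cone_def e(2) by (metis (no_types))
  then show "\<exists>v. C = cone v" ..
qed (use digraph_copiesI[OF tree_embedding] in \<open>auto simp: cone_def\<close>)

lemma cone_append: "cone (v @ w) \<subseteq> cone v"
  unfolding cone_def by auto

lemma self_in_cone: "v \<in> cone v"
  unfolding cone_def by (metis append_Nil2 rangeI)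

lemma cone_inter:
  assumes "x \<in> cone v" "x \<in> cone w"
  shows "cone v \<subseteq> cone w \<or> cone w \<subseteq> cone v"
proof -
  obtain s t where "v @ s = w @ t" using assms unfolding cone_def by auto
  then obtain u where "v = w @ u \<or> w = v @ u" by (auto simp: append_eq_append_conv2)
  then show ?thesis using cone_append by blast
qed

text \<open>Equal length makes the cones disjoint and excludes parent edges between them; distinct
  parents exclude a sibling edge between their tops.\<close>

definition apart :: "bool list \<Rightarrow> bool list \<Rightarrow> bool" where
  "apart u v \<longleftrightarrow> length u = length v \<and> butlast u \<noteq> butlast v"

lemma apart_sym: "apart u v \<Longrightarrow> apart v u"
  unfolding apart_def by auto

lemma apart_neq: "apart u v \<Longrightarrow> u @ s \<noteq> v @ t"
  unfolding apart_def by auto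

lemma apart_no_edge:
  assumes "apart u v"
  shows "(u @ s, v @ t) \<notin> tree"
proof
  assume "(u @ s, v @ t) \<in> tree"
  then consider b where "u @ s @ [b] = v @ t"
    | w where "u @ s = w @ [False]" "v @ t = w @ [True]"
    unfolding tree_def by auto
  then show False
  proof cases
    case 1
    then show False using apart_neq[OF assms] by blast
  next
    case (2 w)
    have len: "length u = length v" using assms by (simp add: apart_def)
    have "length (u @ s) = length (v @ t)" using 2 by simp
    then have "s = [] \<longleftrightarrow> t = []" using len by auto
    moreover have "butlast (u @ s) = butlast (v @ t)" using 2 by simp
    ultimately show False
      using assms apart_neq[OF assms] by (cases "s = []") (auto simp: apart_def butlast_append)
  qed
qed

lemma forest_iff: "(x, y) \<in> forest \<longleftrightarrow> (x, y) \<in> tree \<and> x \<noteq> [] \<and> (x, y) \<noteq> ([False], [True])"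
  unfolding forest_def tree_def by auto

lemma forest_append_iff: "u \<noteq> [] \<Longrightarrow> (u @ s, u @ t) \<in> forest \<longleftrightarrow> (s, t) \<in> tree"
  unfolding forest_iff tree_append_iff by (cases u) auto

text \<open>The isolated vertex goes to \<open>c\<close>. The first letter of any other vertex names
  its tree and is replaced by the top of the cone that receives this tree.\<close>

definition graft :: "bool list \<Rightarrow> bool list \<Rightarrow> bool list \<Rightarrow> bool list \<Rightarrow> bool list" where
  "graft c u v = case_list c (\<lambda>b s. (if b then v else u) @ s)"

text \<open>The edge set \<open>E\<close> is a parameter so that both the tree and the forest can be
  the target.\<close>

lemma graft_embedding:
  assumes uv: "apart u v" and sub: "E \<subseteq> tree"
    and E: "\<And>w s t. w \<in> {u, v} \<Longrightarrow> (w @ s, w @ t) \<in> E \<longleftrightarrow> (s, t) \<in> tree"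
    and c: "\<And>w s. w \<in> {u, v} \<Longrightarrow> c \<noteq> w @ s \<and> (c, w @ s) \<notin> E \<and> (w @ s, c) \<notin> E"
  shows "digraph_embedding forest E (graft c u v)"
proof -
  have cc: "(c, c) \<notin> E" using sub asym_tree(1) by (auto dest: asymD)
  have no: "(u @ s, v @ t) \<notin> E" "(v @ s, u @ t) \<notin> E" "u @ s \<noteq> v @ t" "v @ s \<noteq> u @ t" for s t
    using sub apart_no_edge[OF uv] apart_no_edge[OF apart_sym[OF uv]]
      apart_neq[OF uv] apart_neq[OF apart_sym[OF uv]] by auto
  have forest: "(b # s, b' # t) \<in> forest \<longleftrightarrow> b = b' \<and> (s, t) \<in> tree" for b b' s t
    using forest_append_iff[of "[b]" s t] by (auto simp: forest_def Cons_eq_append_conv)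
  have nil: "([], y) \<notin> forest" "(y, []) \<notin> forest" for y
    unfolding forest_def by auto
  have "graft c u v x = graft c u v y \<Longrightarrow> x = y" for x y
    using c no by (cases x; cases y) (auto simp: graft_def split: if_splits dest: sym)
  moreover have "(x, y) \<in> forest \<longleftrightarrow> (graft c u v x, graft c u v y) \<in> E" for x y
    using c no E cc by (cases x; cases y) (auto simp: graft_def nil forest)
  ultimately show ?thesis unfolding digraph_embedding_def inj_def by blast
qed

lemma tree_equimorphic:
  "digraph_embedding tree forest ((@) [False])"
  "digraph_embedding forest tree (graft [True, True] [False, False, False] [False, True, True])"
proof -
  show "digraph_embedding tree forest ((@) [False])"
    using forest_append_iff[of "[False]"] by (simp add: digraph_embedding_def inj_def)
  \<comment> \<open>Nodes below \<open>[False]\<close> that are apart need length at least 3;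
    \<open>[True, True]\<close> has no neighbour below \<open>[False]\<close>.\<close>
  show "digraph_embedding forest tree (graft [True, True] [False, False, False] [False, True, True])"
  proof (rule graft_embedding)
    show "apart [False, False, False] [False, True, True]" by (simp add: apart_def)
  qed (auto simp: tree_append_iff simp del: append_Cons, auto simp: tree_def Cons_eq_append_conv append_eq_Cons_conv)
qed

definition two_cones :: "bool list \<Rightarrow> bool list \<Rightarrow> bool list set" where
  "two_cones u v = insert [] (cone u \<union> cone v)"

lemma two_cones_copy:
  assumes "apart u v"
  shows "two_cones u v \<in> digraph_copies forest"
proof -
  have ne: "u \<noteq> []" "v \<noteq> []" using assms by (auto simp: apart_def)
  have "digraph_embedding forest forest (graft [] u v)"
  proof (rule graft_embedding[OF assms])
    show "forest \<subseteq> tree" using forest_iff by auto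
    have "([], y) \<notin> forest" "(y, []) \<notin> forest" for y
      unfolding forest_def by auto
    then show "[] \<noteq> w @ s \<and> ([], w @ s) \<notin> forest \<and> (w @ s, []) \<notin> forest"
      if "w \<in> {u, v}" for w s using that ne by auto
  qed (use ne forest_append_iff in auto)
  moreover have "range (graft [] u v) = two_cones u v"
  proof (intro equalityI subsetI)
    fix x assume "x \<in> range (graft [] u v)"
    then obtain y where "x = graft [] u v y" by blast
    then show "x \<in> two_cones u v"
      by (cases y) (auto simp: graft_def two_cones_def cone_def)
  next
    fix x assume "x \<in> two_cones u v"
    then consider "x = graft [] u v []" | s where "x = graft [] u v (False # s)"
      | s where "x = graft [] u v (True # s)"
      unfolding two_cones_def cone_def graft_def by auto
    then show "x \<in> range (graft [] u v)" by cases auto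
  qed
  ultimately show ?thesis using digraph_copiesI by metis
qed

definition sq_treelike :: "'p rel \<Rightarrow> bool" where
  "sq_treelike r \<longleftrightarrow> (\<forall>A B C. (C, A) \<in> sq r \<longrightarrow> (C, B) \<in> sq r \<longrightarrow> (A, B) \<in> sq r \<or> (B, A) \<in> sq r)"

text \<open>Two conditions that are \<open>le_star\<close>-above a third contain a common cone, and
  cones that meet are nested.\<close>

lemma tree_sq_treelike: "sq_treelike (digraph_order tree)"
  unfolding sq_treelike_def
proof (intro allI impI)
  fix A B C assume *: "(C, A) \<in> sq (digraph_order tree)" "(C, B) \<in> sq (digraph_order tree)"
  interpret preord "digraph_order tree" by (rule preord_digraph_order)
  obtain a b c where abc: "a \<in> digraph_copies tree" "b \<in> digraph_copies tree" "c \<in> digraph_copies tree"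
    "A = eq_star (digraph_order tree) `` {a}" "B = eq_star (digraph_order tree) `` {b}"
    "C = eq_star (digraph_order tree) `` {c}"
    using FieldI1[OF *(1)] FieldI2[OF *(1)] FieldI2[OF *(2)] unfolding Field_sq by auto
  then have le: "(c, a) \<in> le_star (digraph_order tree)" "(c, b) \<in> le_star (digraph_order tree)"
    using * sq_iff by auto
  have "(c, c) \<in> digraph_order tree" using abc(3) by (simp add: digraph_order_iff)
  from le_starD[OF le(1) this] obtain d where d: "(d, c) \<in> digraph_order tree" "(d, a) \<in> digraph_order tree"
    by blast
  from le_starD[OF le(2) d(1)] obtain x
    where "(x, d) \<in> digraph_order tree" "(x, b) \<in> digraph_order tree" by blast
  then have x: "x \<in> digraph_copies tree" "x \<subseteq> a" "x \<subseteq> b" using d(2) by (auto simp: digraph_order_iff)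
  obtain u v w where "x = cone u" "a = cone v" "b = cone w" using x(1) abc tree_copies by metis
  moreover from this have "u \<in> cone v" "u \<in> cone w" using x self_in_cone by blast+
  ultimately have "a \<subseteq> b \<or> b \<subseteq> a" using cone_inter by blast
  then have "(a, b) \<in> digraph_order tree \<or> (b, a) \<in> digraph_order tree"
    using abc by (simp add: digraph_order_iff)
  then show "(A, B) \<in> sq (digraph_order tree) \<or> (B, A) \<in> sq (digraph_order tree)"
    using abc sq_iff le_star by auto
qed

text \<open>Unlike a cone, a copy of the forest can be shrunk in two independent places:
  \<open>?p\<close> and \<open>?q\<close> agree in the left tree, where \<open>?m\<close> lies below
  both, and are disjoint in the right tree.\<close>

lemma forest_not_sq_treelike: "\<not> sq_treelike (digraph_order forest)"
proof
  let ?F = False and ?T = True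
  let ?r = "digraph_order forest"
  let ?p = "two_cones [?F, ?F] [?T, ?F]" and ?q = "two_cones [?F, ?F] [?T, ?T]"
  let ?m = "two_cones [?F, ?F, ?F, ?F] [?F, ?F, ?T, ?T]"
  \<comment> \<open>\<open>?p'\<close> lies in the part of \<open>?p\<close> that avoids
    \<open>?q\<close>, and \<open>?q'\<close> in the part of \<open>?q\<close> that avoids
    \<open>?p\<close>; they refute \<open>le_star\<close> in both directions.\<close>
  let ?p' = "two_cones [?T, ?F, ?F, ?F] [?T, ?F, ?T, ?T]"
  let ?q' = "two_cones [?T, ?T, ?F, ?F] [?T, ?T, ?T, ?T]"
  interpret preord ?r by (rule preord_digraph_order)
  have copies: "?p \<in> digraph_copies forest" "?q \<in> digraph_copies forest"
    "?m \<in> digraph_copies forest" "?p' \<in> digraph_copies forest" "?q' \<in> digraph_copies forest"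
    by (rule two_cones_copy; simp add: apart_def)+
  have le: "(?m, ?p) \<in> ?r" "(?m, ?q) \<in> ?r" "(?p', ?p) \<in> ?r" "(?q', ?q) \<in> ?r"
    unfolding digraph_order_iff using copies by (auto simp: two_cones_def cone_def)
  \<comment> \<open>A common extension would be a copy with at most one element, but copies are
    infinite.\<close>
  have incompat: "\<nexists>x. (x, a) \<in> ?r \<and> (x, b) \<in> ?r" if ab: "a \<inter> b \<subseteq> {[]}" for a b
  proof
    assume "\<exists>x. (x, a) \<in> ?r \<and> (x, b) \<in> ?r"
    then obtain x where "x \<in> digraph_copies forest" "x \<subseteq> a \<inter> b"
      unfolding digraph_order_iff by blast
    then have x: "x \<in> digraph_copies forest" "x \<subseteq> {[]}" using ab by auto
    then show False
      using infinite_digraph_copies[OF _ x(1)] infinite_UNIV_listI finite_subset[OF x(2)] by auto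
  qed
  have "?p' \<inter> ?q \<subseteq> {[]}" "?q' \<inter> ?p \<subseteq> {[]}" by (auto simp: two_cones_def cone_def)
  note incompat = this[THEN incompat]
  have "(?p, ?q) \<notin> le_star ?r"
    using le_starD[OF _ le(3), of ?q] incompat(1) by (rule contrapos_nn[rotated])
  moreover have "(?q, ?p) \<notin> le_star ?r"
    using le_starD[OF _ le(4), of ?p] incompat(2) by (rule contrapos_nn[rotated])
  moreover assume treelike: "sq_treelike ?r"
  have "(eq_star ?r `` {?m}, eq_star ?r `` {?p}) \<in> sq ?r"
    "(eq_star ?r `` {?m}, eq_star ?r `` {?q}) \<in> sq ?r"
    using sq_iff copies le_star[OF le(1)] le_star[OF le(2)] by simp_all
  then have "(eq_star ?r `` {?p}, eq_star ?r `` {?q}) \<in> sq ?r \<or>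
      (eq_star ?r `` {?q}, eq_star ?r `` {?p}) \<in> sq ?r"
    using treelike unfolding sq_treelike_def by blast
  then have "(?p, ?q) \<in> le_star ?r \<or> (?q, ?p) \<in> le_star ?r" using sq_iff copies by simp
  ultimately show False by blast
qed

lemma sq_treelike_iso:
  assumes "order_isomorphic (sq r) (sq s)" "sq_treelike s"
  shows "sq_treelike r"
proof -
  obtain f where "bij_betw f (Field (sq r)) (Field (sq s))"
      "\<And>p q. p \<in> Field (sq r) \<Longrightarrow> q \<in> Field (sq r) \<Longrightarrow> (p, q) \<in> sq r \<longleftrightarrow> (f p, f q) \<in> sq s"
    using assms(1) unfolding order_isomorphic_def by blast
  then show ?thesis
    using assms(2) unfolding sq_treelike_def by (meson FieldI1 FieldI2)
qed

text \<open>So below no copy of the tree are all copies compatible, in contrast to the ray.\<close>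

lemma tree_incompatible:
  assumes "C \<in> digraph_copies tree"
  obtains A B where "A \<in> digraph_copies tree" "B \<in> digraph_copies tree" "A \<subseteq> C" "B \<subseteq> C"
    "A \<inter> B = {}"
proof -
  obtain v where "C = cone v" using assms tree_copies by blast
  moreover have "cone (v @ [False]) \<inter> cone (v @ [True]) = {}" by (auto simp: cone_def)
  ultimately show ?thesis using that tree_copies cone_append by metis
qed

section \<open>Separating the relations\<close>

lemma asym_converse: "asym D \<Longrightarrow> asym (D\<inverse>)"
  unfolding asym_on_def by blast

text \<open>A pair of interpretations on one domain refutes the inclusion in all three settings at
  once.\<close>

definition separated :: "'i lang \<Rightarrow> 'a set \<Rightarrow> nat \<Rightarrow> nat \<Rightarrow> bool" where
  "separated L X k l \<longleftrightarrow> (\<exists>\<rho>\<in>Interp L X. \<exists>\<sigma>\<in>Interp L X.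
     sim k ((X, \<rho>), L) ((X, \<sigma>), L) \<and> \<not> sim l ((X, \<rho>), L) ((X, \<sigma>), L))"

context coding
begin

lemma separatedI:
  assumes "sim k (struct D, L) (struct E, L)" "\<not> sim l (struct D, L) (struct E, L)"
  shows "separated L X k l"
  unfolding separated_def using assms code_Interp by blast

lemma copies_struct_converse:
  "asym D \<Longrightarrow> copies L (struct (D\<inverse>)) = copies L (struct D)"
  using copies_struct_eq_iff[OF asym_converse] digraph_copies_converse by blast

lemma order_isomorphic_struct:
  assumes "asym D" "asym E"
  shows "order_isomorphic (copies_order L (struct D)) (copies_order L (struct E)) \<longleftrightarrow>
    order_isomorphic (digraph_order D) (digraph_order E)"
  by (rule order_isomorphic_cong[symmetric]) (simp_all add: copies_order_struct assms)

lemma sq_isomorphic_struct: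
  assumes "asym D" "asym E"
  shows "order_isomorphic (sq (copies_order L (struct D))) (sq (copies_order L (struct E))) \<longleftrightarrow>
    order_isomorphic (sq (digraph_order D)) (sq (digraph_order E))"
  by (rule order_isomorphic_cong[symmetric]) (simp_all add: copies_order_struct assms sq_iso)

end

lemma ex_coding:
  fixes X :: "'a set"
  assumes "L i0 = Some n" "n \<ge> 2" and X: "infinite X"
  obtains h :: "'a \<Rightarrow> 'z::countable + ('a \<times> nat)" and R where "coding L i0 n X h R"
proof -
  have ne: "X \<noteq> {}" using X by auto
  obtain h :: "'a \<Rightarrow> 'z + ('a \<times> nat)" where h: "bij_betw h X (UNIV <+> X \<times> UNIV)"
    using ex_coding_bij[OF X] .
  obtain R :: "('a \<times> nat) rel" where R: "\<forall>a\<in>X. ((a, 0), (a, 0)) \<in> R" "antisym R"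
      "rigid_on (X \<times> UNIV) R"
    using ex_rigid[OF ne] .
  have "coding L i0 n X h R" by (intro coding.intro assms(1,2) ne h R)
  then show ?thesis by (rule that)
qed

lemma separated:
  fixes L :: "'i lang" and X :: "'a set"
  assumes L: "L i0 = Some n" "n \<ge> 2" and X: "infinite X"
  shows "separated L X 1 0" "separated L X 2 3" "separated L X 3 4" "separated L X 4 9"
    "separated L X 7 6" "separated L X 9 8" "separated L X 11 10"
proof -
  \<comment> \<open>Two codings over the same domain are fixed, because the examples have vertices
    in \<open>nat\<close> and in \<open>bool list\<close>.\<close>
  obtain h :: "'a \<Rightarrow> nat + ('a \<times> nat)" and R where "coding L i0 n X h R"
    using ex_coding[of L i0 n X, OF assms] .
  then interpret c: coding L i0 n X h R .
  obtain h' :: "'a \<Rightarrow> bool list + ('a \<times> nat)" and R' where "coding L i0 n X h' R'"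
    using ex_coding[of L i0 n X, OF assms] .
  then interpret t: coding L i0 n X h' R' .
  have arrow': "asym (arrow\<inverse>)" and zigzag': "asym (zigzag\<inverse>)" and star': "asym ((star c)\<inverse>)" for c
    using arrow(1) zigzag(1) asym_star asym_converse by blast+
  have "arrow\<inverse> \<noteq> arrow" using arrow(2) by simp
  from c.code_neq[OF this] show "separated L X 1 0"
    using arrow(3) c.isomorphic_struct_iff[OF arrow(1) arrow'] c.copies_struct_converse[OF arrow(1)]
    by (intro c.separatedI[of 1 arrow "arrow\<inverse>" 0]) (auto simp: sim_def)
  show "separated L X 2 3"
    using zigzag c.isomorphic_struct_iff[OF zigzag(1) zigzag']
      c.equimorphic_struct_iff[OF zigzag(1) zigzag'] c.copies_struct_converse[OF zigzag(1)]
    by (intro c.separatedI[of 2 zigzag "zigzag\<inverse>" 3]) (auto simp: sim_def)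
  show "separated L X 3 4"
    using c.isomorphic_struct_iff[OF asym_star asym_star, of 0 1] star_iso star_copies
      c.copies_struct_eq_iff[OF asym_star asym_star, of 0 1]
    by (intro c.separatedI[of 3 "star 0" "star 1" 4]) (simp_all add: sim_def)
  show "separated L X 4 9"
    using c.equimorphic_struct_iff[OF asym_star star', of 0 0] star_converse
      c.copies_struct_converse[OF asym_star, of 0]
    by (intro c.separatedI[of 4 "star 0" "(star 0)\<inverse>" 9]) (simp_all add: sim_def)
  have nonempty: "Field (digraph_order D) \<noteq> {}" for D :: "'z rel"
    using UNIV_digraph_copies by auto
  have "order_isomorphic (sq (digraph_order ray)) (sq (digraph_order ray_plus))"
    by (intro sq_directed_iso preord_digraph_order ray_directed ray_plus_directed nonempty)
  moreover have "equimorphic L (c.struct ray) (c.struct ray_plus)"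
    unfolding c.equimorphic_struct_iff[OF asym_ray] using ray_equimorphic by blast
  ultimately show "separated L X 7 6"
    using ray_not_order_isomorphic
      c.order_isomorphic_struct[OF asym_ray] c.sq_isomorphic_struct[OF asym_ray]
    by (intro c.separatedI[of 7 ray ray_plus 6]) (simp_all add: sim_def)
  have "\<not> order_isomorphic (sq (digraph_order forest)) (sq (digraph_order tree))"
    using sq_treelike_iso tree_sq_treelike forest_not_sq_treelike by blast
  moreover have "equimorphic L (t.struct forest) (t.struct tree)"
    unfolding t.equimorphic_struct_iff[OF asym_tree(2,1)] using tree_equimorphic by blast
  ultimately show "separated L X 9 8"
    using t.sq_isomorphic_struct[OF asym_tree(2,1)]
    by (intro t.separatedI[of 9 forest tree 8]) (simp_all add: sim_def)
  \<comment> \<open>This example compares structures from different codings. The copies of the ray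
    form a chain, so forcing with them adds nothing, while every copy of the tree contains two
    disjoint ones.\<close>
  let ?P = "copies_order L (t.struct tree)" and ?Q = "copies_order L (c.struct ray)"
  have "\<not> forcing_equivalent ?P ?Q"
  proof
    assume "forcing_equivalent ?P ?Q"
    then have ge: "ge_subset ?P ?Q" unfolding forcing_equivalent_def ..
    have dir: "\<exists>t. (t, q) \<in> ?Q \<and> (t, q') \<in> ?Q" if q: "q \<in> Field ?Q" "q' \<in> Field ?Q" for q q'
    proof -
      obtain C C' where C: "C \<in> digraph_copies ray" "C' \<in> digraph_copies ray"
          "q = c.extend C" "q' = c.extend C'"
        using q by (auto simp: c.copies_struct[OF asym_ray(1)])
      then have "q \<subseteq> q' \<or> q' \<subseteq> q" using ray_total c.extend_mono_iff by simp
      then show ?thesis using q by (auto simp: copies_order_iff)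
    qed
    have "t.extend UNIV \<in> Field ?P"
      by (simp add: t.copies_struct[OF asym_tree(1)] UNIV_digraph_copies)
    from ge_subset_directed[OF preord_copies_order preord_copies_order ge dir this]
    obtain p where p: "p \<in> copies L (t.struct tree)"
      and compat: "\<And>q q'. (q, p) \<in> ?P \<Longrightarrow> (q', p) \<in> ?P \<Longrightarrow> \<exists>u. (u, q) \<in> ?P \<and> (u, q') \<in> ?P"
      by (auto simp: copies_order_iff)
    obtain C where C: "C \<in> digraph_copies tree" "p = t.extend C"
      using p by (auto simp: t.copies_struct[OF asym_tree(1)])
    obtain A B where AB: "A \<in> digraph_copies tree" "B \<in> digraph_copies tree" "A \<subseteq> C" "B \<subseteq> C"
        "A \<inter> B = {}"
      using tree_incompatible[OF C(1)] .
    then have "(t.extend A, p) \<in> ?P" "(t.extend B, p) \<in> ?P"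
      unfolding copies_order_iff C(2)
      using C(1) t.extend_mono_iff by (simp_all add: t.copies_struct[OF asym_tree(1)])
    then obtain u where "(u, t.extend A) \<in> ?P" "(u, t.extend B) \<in> ?P" using compat by blast
    then obtain U where U: "U \<in> digraph_copies tree" "t.extend U \<subseteq> t.extend A" "t.extend U \<subseteq> t.extend B"
      by (auto simp: copies_order_iff t.copies_struct[OF asym_tree(1)])
    then have "U = {}" using AB(5) t.extend_mono_iff by blast
    then show False using U(1) unfolding digraph_copies_def by auto
  qed
  then show "separated L X 11 10"
    unfolding separated_def using t.code_Interp[of tree] c.code_Interp[of ray]
    by (intro bexI[of _ "t.code tree"] bexI[of _ "c.code ray"]) (simp_all add: sim_def)
qed

section \<open>The hierarchy on interpretations, on structures and on pairs\<close>

lemma hierarchy_Interp: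
  assumes "L i0 = Some n" "n \<ge> 2" "infinite X"
  shows "hierarchy (sim_Interp L X)"
proof -
  have "\<not> sim_Interp L X k \<subseteq> sim_Interp L X l" if "separated L X k l" for k l
    using that unfolding separated_def sim_Interp_def by blast
  note neg = separated[of L i0 n X, OF assms, THEN this]
  have "sim_Interp L X k \<subseteq> sim_Interp L X l" if "(k, l) \<in> basic_pairs" for k l
    unfolding sim_Interp_def using sim_mono[OF that] by blast
  then show ?thesis using neg by (rule hierarchyI)
qed

lemma hierarchy_Mod:
  assumes "L i0 = Some n" "n \<ge> 2" "infinite X"
  shows "hierarchy (sim_Mod L X)"
proof -
  have "\<not> sim_Mod L X k \<subseteq> sim_Mod L X l" if "separated L X k l" for k l
    using that unfolding separated_def sim_Mod_def Mod_def by blast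
  note neg = separated[of L i0 n X, OF assms, THEN this]
  have "sim_Mod L X k \<subseteq> sim_Mod L X l" if "(k, l) \<in> basic_pairs" for k l
    unfolding sim_Mod_def using sim_mono[OF that] by blast
  then show ?thesis using neg by (rule hierarchyI)
qed

lemma hierarchy_all:
  assumes "infinite (UNIV :: 'b set)"
  shows "hierarchy (sim_all :: nat \<Rightarrow> (('j, 'b) struct \<times> 'j lang) rel)"
proof -
  \<comment> \<open>One binary relation on the whole type suffices; \<open>undefined\<close> is an
    index that exists in every type \<open>'j\<close>.\<close>
  let ?L = "[undefined \<mapsto> 2] :: 'j lang" and ?X = "UNIV :: 'b set"
  let ?sim = "sim_all :: nat \<Rightarrow> (('j, 'b) struct \<times> 'j lang) rel"
  have pair: "((?X, \<rho>), ?L) \<in> all_pairs" if "\<rho> \<in> Interp ?L ?X" for \<rho>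
    using that unfolding all_pairs_def language_def Mod_def by auto
  have "\<not> ?sim k \<subseteq> ?sim l" if "separated ?L ?X k l" for k l
    using that pair unfolding separated_def sim_all_def by blast
  moreover have "?L undefined = Some 2" "(2::nat) \<ge> 2" by auto
  ultimately have neg: "separated ?L ?X k l \<Longrightarrow> \<not> ?sim k \<subseteq> ?sim l"
    and L: "?L undefined = Some 2" "(2::nat) \<ge> 2" for k l by blast+
  note neg = separated[of ?L undefined 2 ?X, OF L assms, THEN neg]
  have "?sim k \<subseteq> ?sim l" if "(k, l) \<in> basic_pairs" for k l
    unfolding sim_all_def using sim_mono[OF that] by blast
  then show ?thesis using neg by (rule hierarchyI)
qed

theorem theorem3p7:
  fixes L :: "'i lang" and \<kappa> :: "'a rel"
  assumes "language L" and "\<not> unary L" and "Cinfinite \<kappa>"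
  shows "hierarchy (sim_Interp L (Field \<kappa>)) \<and>
         hierarchy (sim_Mod L (Field \<kappa>)) \<and>
         (infinite (UNIV :: 'b set) \<longrightarrow>
            hierarchy (sim_all :: nat \<Rightarrow> (('j, 'b) struct \<times> 'j lang) rel))"
proof -
  obtain n i0 where "L i0 = Some n" "n \<noteq> 1"
    using assms(2) unfolding unary_def ran_def by blast
  moreover from this have "n \<ge> 1" using assms(1) unfolding language_def ran_def by blast
  ultimately have "L i0 = Some n" "n \<ge> 2" by auto
  moreover have "infinite (Field \<kappa>)" using assms(3) by (simp add: cinfinite_def)
  ultimately show ?thesis
    using hierarchy_Interp[of L i0 n] hierarchy_Mod[of L i0 n] hierarchy_all by blast
qed

end
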